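(* Let $\Gamma$ be a distance-regular graph with vertex set $X$ and diameter $d\geqslant 3$ having classical parameters $(d,q,\alpha,\beta)$, equipped with its standard $Q$-polynomial ordering. Let $\mathscr{P}$ be the set of all descendents of $\Gamma$. Suppose that for every $i$ $(0\leqslant i\leqslant d)$, any two vertices $x,y\in X$ at distance $i$ are contained in a unique member of $\mathscr{P}$ with width $i$. Then $Y_1\cap Y_2\in\mathscr{P}$ for all $Y_1,Y_2\in\mathscr{P}$ such that $Y_1\cap Y_2\neq\emptyset$.
   Context: All graphs are finite, simple and undirected. Let $\Gamma$ be a connected graph with vertex set $X$, path-length distance $\partial$ and diameter $d$; let $A_i\in\mathbb{C}^{X\times X}$ be the adjacency matrix of the distance-$i$ graph ($A_0=I$). $\Gamma$ is distance-regular if there are integers $b_i,c_i$ such that whenever $\partial(x,y)=i$, $y$ has exactly $b_i$ (resp. $c_i$) neighbours at distance $i+1$ (resp. $i-1$) from $x$. Then the Bose--Mesner algebra $\langle A_0,\dots,A_d\rangle$ (complex span) is a commutative semisimple algebra with a basis of primitive idempotents $E_0=|X|^{-1}J,E_1,\dots,E_d$. $\Gamma$ is $Q$-polynomial with respect to the ordering $\{E_i\}_{i=0}^d$ if there are scalars $a_i^*,b_i^*,c_i^*$ with $b_d^*=c_0^*=0$, $b_{i-1}^*c_i^*\neq 0$ $(1\leqslant i\leqslant d)$ and $E_1\circ E_i=|X|^{-1}(b_{i-1}^*E_{i-1}+a_i^*E_i+c_{i+1}^*E_{i+1})$ $(0\leqslant i\leqslant d)$, where $\circ$ is the entrywise product,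 $E_{-1}=E_{d+1}=0$, $b_{-1}^*=c_{d+1}^*=0$. Write $|X|E_1=\sum_{i=0}^d\theta_i^*A_i$. For a nonempty $Y\subseteq X$ with characteristic vector $\hat Y$, the width is $w=\max\{i:\hat Y^{\mathsf T}A_i\hat Y\neq 0\}$ and the dual width is $w^*=\max\{i:\hat Y^{\mathsf T}E_i\hat Y\neq 0\}$. One always has $w+w^*\geqslant d$; $Y$ is a descendent of $\Gamma$ if $w+w^*=d$. Put $[i]_q=1+q+\dots+q^{i-1}$. $\Gamma$ has classical parameters $(d,q,\alpha,\beta)$ if $b_i=([d]_q-[i]_q)(\beta-\alpha[i]_q)$ and $c_i=[i]_q(1+\alpha[i-1]_q)$ for $0\leqslant i\leqslant d$. Then $\Gamma$ has a $Q$-polynomial ordering, called standard, for which $\theta_i^*=\xi^*[d-i]_q+\zeta^*$ for some scalars $\xi^*\neq 0$, $\zeta^*$. *)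

theory Defs
  imports Complex_Main "HOL-Library.Indicator_Function"
begin

text \<open>
  A graph is a vertex set \<open>X\<close> with its adjacency relation \<open>R\<close>, stored as the set of ordered
  pairs of adjacent vertices.
\<close>

definition simple_graph :: "'a set \<Rightarrow> 'a rel \<Rightarrow> bool" where
  "simple_graph X R \<longleftrightarrow> finite X \<and> X \<noteq> {} \<and> R \<subseteq> X \<times> X \<and> sym R \<and> irrefl R"

definition connected_graph :: "'a set \<Rightarrow> 'a rel \<Rightarrow> bool" where
  "connected_graph X R \<longleftrightarrow> simple_graph X R \<and> (\<forall>x\<in>X. \<forall>y\<in>X. (x, y) \<in> R\<^sup>*)"

text \<open>
  \<open>R ^^ n\<close> relates the endpoints of walks of length \<open>n\<close>. The value of \<open>gdist\<close> is only
  meaningful when the two vertices are joined by a walk.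
\<close>

definition gdist :: "'a rel \<Rightarrow> 'a \<Rightarrow> 'a \<Rightarrow> nat" where
  "gdist R x y = (LEAST n. (x, y) \<in> R ^^ n)"

definition graph_diameter :: "'a set \<Rightarrow> 'a rel \<Rightarrow> nat" where
  "graph_diameter X R = Max {gdist R x y | x y. x \<in> X \<and> y \<in> X}"

definition intersection_array :: "'a set \<Rightarrow> 'a rel \<Rightarrow> (nat \<Rightarrow> nat) \<Rightarrow> (nat \<Rightarrow> nat) \<Rightarrow> bool" where
  "intersection_array X R b c \<longleftrightarrow>
     (\<forall>i\<le>graph_diameter X R. \<forall>x\<in>X. \<forall>y\<in>X. gdist R x y = i \<longrightarrow>
        card {z \<in> X. (y, z) \<in> R \<and> gdist R x z = i + 1} = b i \<and>
        card {z \<in> X. (y, z) \<in> R \<and> gdist R x z + 1 = i} = c i)"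

definition distance_regular :: "'a set \<Rightarrow> 'a rel \<Rightarrow> bool" where
  "distance_regular X R \<longleftrightarrow> connected_graph X R \<and> (\<exists>b c. intersection_array X R b c)"

definition qnum :: "real \<Rightarrow> nat \<Rightarrow> real" where
  "qnum q i = (\<Sum>j<i. q ^ j)"

text \<open>For \<open>i = 0\<close> the factor \<open>qnum q i\<close> vanishes, so the truncated \<open>i - 1\<close> is harmless.\<close>

definition classical_parameters ::
    "'a set \<Rightarrow> 'a rel \<Rightarrow> nat \<Rightarrow> real \<Rightarrow> real \<Rightarrow> real \<Rightarrow> bool" where
  "classical_parameters X R d q \<alpha> \<beta> \<longleftrightarrow>
     graph_diameter X R = d \<and>
     (\<exists>b c. intersection_array X R b c \<and>
        (\<forall>i\<le>d. real (b i) = (qnum q d - qnum q i) * (\<beta> - \<alpha> * qnum q i) \<and>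
               real (c i) = qnum q i * (1 + \<alpha> * qnum q (i - 1))))"

text \<open>
  A complex matrix with rows and columns indexed by \<open>X\<close> is a function on pairs of points that
  vanishes outside \<open>X \<times> X\<close>. All matrices in the span of the distance matrices have this form, so
  equality of functions is equality of matrices.
\<close>

type_synonym 'a cmat = "'a \<Rightarrow> 'a \<Rightarrow> complex"

definition mat_mult :: "'a set \<Rightarrow> 'a cmat \<Rightarrow> 'a cmat \<Rightarrow> 'a cmat" where
  "mat_mult X M N = (\<lambda>x y. \<Sum>z\<in>X. M x z * N z y)"

definition zero_mat :: "'a cmat" where
  "zero_mat = (\<lambda>x y. 0)"

definition all_ones :: "'a set \<Rightarrow> 'a cmat" where
  "all_ones X = (\<lambda>x y. if x \<in> X \<and> y \<in> X then 1 else 0)"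

definition distance_matrix :: "'a set \<Rightarrow> 'a rel \<Rightarrow> nat \<Rightarrow> 'a cmat" where
  "distance_matrix X R i = (\<lambda>x y. if x \<in> X \<and> y \<in> X \<and> gdist R x y = i then 1 else 0)"

definition bose_mesner :: "'a set \<Rightarrow> 'a rel \<Rightarrow> 'a cmat set" where
  "bose_mesner X R =
     {M. \<exists>k :: nat \<Rightarrow> complex. M = (\<lambda>x y. \<Sum>i\<le>graph_diameter X R. k i * distance_matrix X R i x y)}"

definition idempotents :: "'a set \<Rightarrow> 'a rel \<Rightarrow> 'a cmat set" where
  "idempotents X R = {M \<in> bose_mesner X R. mat_mult X M M = M}"

definition primitive_idempotents :: "'a set \<Rightarrow> 'a rel \<Rightarrow> 'a cmat set" where
  "primitive_idempotents X R =
     {M \<in> idempotents X R. M \<noteq> zero_mat \<and>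
        (\<forall>F \<in> idempotents X R. \<forall>G \<in> idempotents X R.
           mat_mult X F G = zero_mat \<and> mat_mult X G F = zero_mat \<and> M = (\<lambda>x y. F x y + G x y)
             \<longrightarrow> F = zero_mat \<or> G = zero_mat)}"

definition idempotent_ordering :: "'a set \<Rightarrow> 'a rel \<Rightarrow> (nat \<Rightarrow> 'a cmat) \<Rightarrow> bool" where
  "idempotent_ordering X R E \<longleftrightarrow>
     bij_betw E {0..graph_diameter X R} (primitive_idempotents X R) \<and>
     E 0 = (\<lambda>x y. all_ones X x y / of_nat (card X))"

text \<open>
  In \<open>Q_polynomial\<close> the conditionals express the conventions that the idempotents with indices
  \<open>- 1\<close> and \<open>d + 1\<close> are zero; \<open>a\<close>, \<open>b\<close>, \<open>c\<close> are the starred scalars (dual intersection numbers).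
\<close>

definition Q_polynomial :: "'a set \<Rightarrow> 'a rel \<Rightarrow> (nat \<Rightarrow> 'a cmat) \<Rightarrow> bool" where
  "Q_polynomial X R E \<longleftrightarrow>
     idempotent_ordering X R E \<and>
     (let d = graph_diameter X R in
      \<exists>a b c :: nat \<Rightarrow> complex.
        b d = 0 \<and> c 0 = 0 \<and> (\<forall>i\<in>{1..d}. b (i - 1) * c i \<noteq> 0) \<and>
        (\<forall>i\<le>d. \<forall>x y. E 1 x y * E i x y =
           ((if i = 0 then 0 else b (i - 1) * E (i - 1) x y)
             + a i * E i x y
             + (if i = d then 0 else c (i + 1) * E (i + 1) x y)) / of_nat (card X)))"

definition dual_eigenvalues ::
    "'a set \<Rightarrow> 'a rel \<Rightarrow> (nat \<Rightarrow> 'a cmat) \<Rightarrow> (nat \<Rightarrow> complex) \<Rightarrow> bool" where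
  "dual_eigenvalues X R E \<theta> \<longleftrightarrow>
     (\<forall>x y. of_nat (card X) * E 1 x y =
        (\<Sum>i\<le>graph_diameter X R. \<theta> i * distance_matrix X R i x y))"

definition standard_ordering ::
    "'a set \<Rightarrow> 'a rel \<Rightarrow> real \<Rightarrow> (nat \<Rightarrow> 'a cmat) \<Rightarrow> bool" where
  "standard_ordering X R q E \<longleftrightarrow>
     Q_polynomial X R E \<and>
     (\<exists>\<theta> \<xi> \<zeta>. dual_eigenvalues X R E \<theta> \<and> \<xi> \<noteq> 0 \<and>
        (\<forall>i\<le>graph_diameter X R.
           \<theta> i = \<xi> * complex_of_real (qnum q (graph_diameter X R - i)) + \<zeta>))"

definition quad_form :: "'a set \<Rightarrow> 'a cmat \<Rightarrow> 'a set \<Rightarrow> complex" where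
  "quad_form X M Y = (\<Sum>x\<in>X. \<Sum>y\<in>X. indicator Y x * M x y * indicator Y y)"

definition width :: "'a set \<Rightarrow> 'a rel \<Rightarrow> 'a set \<Rightarrow> nat" where
  "width X R Y =
     Max {i. i \<le> graph_diameter X R \<and> quad_form X (distance_matrix X R i) Y \<noteq> 0}"

definition dual_width :: "'a set \<Rightarrow> 'a rel \<Rightarrow> (nat \<Rightarrow> 'a cmat) \<Rightarrow> 'a set \<Rightarrow> nat" where
  "dual_width X R E Y = Max {i. i \<le> graph_diameter X R \<and> quad_form X (E i) Y \<noteq> 0}"

definition descendents :: "'a set \<Rightarrow> 'a rel \<Rightarrow> (nat \<Rightarrow> 'a cmat) \<Rightarrow> 'a set set" where
  "descendents X R E =
     {Y. Y \<subseteq> X \<and> Y \<noteq> {} \<and> width X R Y + dual_width X R E Y = graph_diameter X R}"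

end

theory Submission
  imports Defs "HOL-Computational_Algebra.Polynomial"
begin

text \<open>
  Say that a function on \<open>X\<close> has degree at most \<open>m\<close> if it is annihilated by \<open>E k\<close> for all
  \<open>k > m\<close>. Degrees add under pointwise multiplication, so a descendent of width \<open>w\<close> is a set
  whose indicator function has degree \<open>d - w\<close>, the least possible for its width; this also makes
  it maximal among the sets of width \<open>w\<close>. Let a hyperplane be a descendent of width \<open>d - 1\<close>, i.e.
  one of degree 1. The number of hyperplanes containing two vertices at distance \<open>j\<close> turns out to
  be \<open>[d - j]\<close>, which decreases strictly with \<open>j\<close>. Intersecting hyperplanes through \<open>x\<close> and \<open>y\<close>
  one at a time therefore lowers the width and raises the degree by one in each step, until the
  unique descendent \<open>S(x,y)\<close> of width \<open>\<partial>(x,y)\<close> is reached. Hence every descendent other than \<open>X\<close>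
  is an intersection of hyperplanes, and \<open>S(x,y)\<close> lies in every descendent containing \<open>x\<close> and
  \<open>y\<close>. If \<open>x\<close> and \<open>y\<close> are two points of \<open>Y\<^sub>1 \<inter> Y\<^sub>2\<close> at maximal distance, then
  \<open>S(x,y) \<subseteq> Y\<^sub>1 \<inter> Y\<^sub>2\<close>, and equality holds by maximality.
\<close>

section \<open>Distance-regular graphs\<close>

locale distance_regular_graph =
  fixes X :: "'a set" and R :: "'a rel" and d :: nat and b c :: "nat \<Rightarrow> nat"
  assumes connected: "connected_graph X R"
    and diameter: "graph_diameter X R = d"
    and array: "intersection_array X R b c"
begin

abbreviation D :: "'a \<Rightarrow> 'a \<Rightarrow> nat" where
  "D \<equiv> gdist R"

definition sphere :: "'a \<Rightarrow> nat \<Rightarrow> 'a set" where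
  "sphere x j = {z \<in> X. D x z = j}"

lemma finite_X [simp]: "finite X" and X_nonempty [simp]: "X \<noteq> {}" and R_subset: "R \<subseteq> X \<times> X"
  and sym_R: "sym R" and irrefl_R: "irrefl R"
  using connected by (auto simp: connected_graph_def simple_graph_def)

section \<open>Path-length distance, spheres and intersection numbers\<close>

lemma R_sym: "(x, y) \<in> R \<Longrightarrow> (y, x) \<in> R"
  using sym_R by (auto dest: symD)

lemma R_in_X: "(x, y) \<in> R \<Longrightarrow> x \<in> X" "(x, y) \<in> R \<Longrightarrow> y \<in> X"
  using R_subset by auto

lemma relpow_R_sym: "(x, y) \<in> R ^^ n \<Longrightarrow> (y, x) \<in> R ^^ n"
proof (induction n arbitrary: y)
  case (Suc n)
  then obtain z where "(x, z) \<in> R ^^ n" "(z, y) \<in> R" by auto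
  then show ?case using Suc.IH R_sym by (meson relpow_Suc_I2)
qed auto

lemma walk_D: "x \<in> X \<Longrightarrow> y \<in> X \<Longrightarrow> (x, y) \<in> R ^^ D x y"
proof -
  assume "x \<in> X" "y \<in> X"
  then have "(x, y) \<in> R\<^sup>*" using connected by (auto simp: connected_graph_def)
  then obtain n where "(x, y) \<in> R ^^ n" by (auto simp: rtrancl_power)
  then show ?thesis unfolding gdist_def by (rule LeastI)
qed

lemma D_le: "(x, y) \<in> R ^^ n \<Longrightarrow> D x y \<le> n"
  unfolding gdist_def by (rule Least_le)

lemma D_self [simp]: "D x x = 0"
  using D_le[of x x 0] by simp

lemma D_eq_0_iff: "x \<in> X \<Longrightarrow> y \<in> X \<Longrightarrow> D x y = 0 \<longleftrightarrow> x = y"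
  using walk_D[of x y] by auto

lemma D_sym: "x \<in> X \<Longrightarrow> y \<in> X \<Longrightarrow> D x y = D y x"
  by (meson D_le antisym relpow_R_sym walk_D)

lemma D_triangle:
  assumes "x \<in> X" "y \<in> X" "z \<in> X"
  shows "D x z \<le> D x y + D y z"
  using walk_D[OF assms(1,2)] walk_D[OF assms(2,3)]
  by (intro D_le) (auto simp: relpow_add)

lemma D_eq_1_iff: "x \<in> X \<Longrightarrow> y \<in> X \<Longrightarrow> D x y = 1 \<longleftrightarrow> (x, y) \<in> R"
proof
  assume *: "x \<in> X" "y \<in> X"
  show "(x, y) \<in> R" if "D x y = 1" using walk_D[OF *] that by simp
  assume R: "(x, y) \<in> R"
  then have "x \<noteq> y" using irrefl_R by (auto simp: irrefl_def)
  moreover have "D x y \<le> 1" using D_le[of x y 1] R by simp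
  ultimately show "D x y = 1" using D_eq_0_iff[OF *] by linarith
qed

lemma D_adjacent:
  assumes "x \<in> X" "(y, z) \<in> R"
  shows "D x z \<le> D x y + 1" "D x y \<le> D x z + 1"
  using D_triangle[of x y z] D_triangle[of x z y] D_eq_1_iff[of y z] D_eq_1_iff[of z y]
    assms R_in_X R_sym by force+

lemma D_predecessor:
  assumes "x \<in> X" "y \<in> X" "D x y = Suc n"
  obtains z where "z \<in> X" "(z, y) \<in> R" "D x z = n"
proof -
  have "(x, y) \<in> R ^^ Suc n" using walk_D assms by metis
  then obtain z where z: "(x, z) \<in> R ^^ n" "(z, y) \<in> R" by auto
  have "D x z \<le> n" using z D_le by auto
  moreover have "Suc n \<le> D x z + 1" using D_adjacent(1)[OF assms(1) z(2)] assms by simp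
  ultimately show ?thesis using that z R_in_X by auto
qed

lemma finite_distances: "finite {D x y | x y. x \<in> X \<and> y \<in> X}"
proof -
  have "{D x y | x y. x \<in> X \<and> y \<in> X} = (\<lambda>(x, y). D x y) ` (X \<times> X)" by auto
  then show ?thesis by simp
qed

lemma D_le_d: "x \<in> X \<Longrightarrow> y \<in> X \<Longrightarrow> D x y \<le> d"
  using diameter finite_distances unfolding graph_diameter_def by (auto intro!: Max_ge)

lemma diameter_attained: "\<exists>x\<in>X. \<exists>y\<in>X. D x y = d"
proof -
  have "{D x y | x y. x \<in> X \<and> y \<in> X} \<noteq> {}" using X_nonempty by blast
  from Max_in[OF finite_distances this] have "d \<in> {D x y | x y. x \<in> X \<and> y \<in> X}"
    using diameter unfolding graph_diameter_def by simp
  then show ?thesis by blast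
qed

lemma card_forward:
  "x \<in> X \<Longrightarrow> y \<in> X \<Longrightarrow> card {z \<in> X. (y, z) \<in> R \<and> D x z = D x y + 1} = b (D x y)"
  and card_backward:
  "x \<in> X \<Longrightarrow> y \<in> X \<Longrightarrow> card {z \<in> X. (y, z) \<in> R \<and> D x z + 1 = D x y} = c (D x y)"
  using array diameter D_le_d unfolding intersection_array_def by blast+

text \<open>Walking back along a geodesic of length \<open>d\<close> gives a vertex at distance
  \<open>Suc n\<close> from \<open>x\<close> together with its predecessor at distance
  \<open>n\<close>; the first is among the neighbours of the second that \<open>b n\<close>
  counts.\<close>

lemma b_pos:
  assumes "n < d"
  shows "b n > 0"
proof -
  obtain x y where xy: "x \<in> X" "y \<in> X" "D x y = d" using diameter_attained by auto
  have "\<exists>z\<in>X. D x z = d - k" if "k \<le> d" for k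
    using that
  proof (induction k)
    case (Suc k)
    then obtain z where z: "z \<in> X" "D x z = Suc (d - Suc k)" by (auto simp: Suc_diff_Suc)
    then show ?case using D_predecessor[OF xy(1) z] by metis
  qed (use xy in auto)
  from this[of "d - Suc n"] obtain y where y: "y \<in> X" "D x y = Suc n" using assms by auto
  obtain z where z: "z \<in> X" "(z, y) \<in> R" "D x z = n" using D_predecessor[OF xy(1) y] .
  then have "y \<in> {w \<in> X. (z, w) \<in> R \<and> D x w = D x z + 1}" using y by auto
  then have "card {w \<in> X. (z, w) \<in> R \<and> D x w = D x z + 1} \<noteq> 0" by (subst card_0_eq) auto
  then show ?thesis using card_forward[OF xy(1) z(1)] z(3) by (metis neq0_conv)
qed

text \<open>Since \<open>b\<close> does not depend on the base vertex, \<open>b_pos\<close> lets one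
  step outwards from every \<open>x\<close>, not only from an end of a diametral pair.\<close>

lemma sphere_nonempty:
  assumes "x \<in> X" "n \<le> d"
  shows "sphere x n \<noteq> {}"
  using assms(2)
proof (induction n)
  case 0
  then show ?case using assms(1) by (auto simp: sphere_def)
next
  case (Suc n)
  then obtain z where z: "z \<in> X" "D x z = n" by (auto simp: sphere_def)
  have "card {w \<in> X. (z, w) \<in> R \<and> D x w = D x z + 1} \<noteq> 0"
    using card_forward[OF assms(1) z(1)] b_pos[of n] Suc.prems z by simp
  then have "{w \<in> X. (z, w) \<in> R \<and> D x w = D x z + 1} \<noteq> {}" by (metis card.empty)
  then show ?case using z(2) by (auto simp: sphere_def)
qed

lemma finite_sphere [simp]: "finite (sphere x n)"
  by (simp add: sphere_def)

lemma c_pos: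
  assumes "n < d"
  shows "c (Suc n) > 0"
proof -
  obtain x where x: "x \<in> X" using X_nonempty by blast
  obtain y where y: "y \<in> X" "D x y = Suc n"
    using sphere_nonempty[OF x, of "Suc n"] assms by (auto simp: sphere_def)
  obtain z where z: "z \<in> X" "(z, y) \<in> R" "D x z = n" using D_predecessor[OF x y] .
  then have "z \<in> {w \<in> X. (y, w) \<in> R \<and> D x w + 1 = D x y}" using y R_sym by auto
  then have "card {w \<in> X. (y, w) \<in> R \<and> D x w + 1 = D x y} \<noteq> 0" by (subst card_0_eq) auto
  then show ?thesis using card_backward[OF x y(1)] y(2) by (metis neq0_conv)
qed

subsection \<open>The Bose-Mesner algebra\<close>

definition rad :: "(nat \<Rightarrow> complex) \<Rightarrow> 'a cmat" where
  "rad m = (\<lambda>x y. if x \<in> X \<and> y \<in> X then m (D x y) else 0)"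

lemma bose_mesner_iff: "M \<in> bose_mesner X R \<longleftrightarrow> (\<exists>m. M = rad m)"
proof -
  have "(\<lambda>x y. \<Sum>i\<le>d. k i * distance_matrix X R i x y) = rad k" for k
    using D_le_d by (auto simp: fun_eq_iff rad_def distance_matrix_def if_distrib[of "(*) _"] cong: if_cong)
  then show ?thesis using diameter by (auto simp: bose_mesner_def)
qed

text \<open>The neighbours of \<open>x\<close> are split by whether they are farther from
  \<open>y\<close> than \<open>x\<close>, nearer, or equally far. At distance 0 the set
  \<open>B\<close> is empty, so \<open>c 0 = 0\<close> and the truncated \<open>D x y - 1\<close>
  does no harm.\<close>

lemma sum_neighbours:
  fixes m :: "nat \<Rightarrow> complex"
  assumes "x \<in> X" "y \<in> X"
  shows "(\<Sum>w\<in>{w \<in> X. (x, w) \<in> R}. m (D w y)) =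
    of_nat (b (D x y)) * m (D x y + 1) + of_nat (c (D x y)) * m (D x y - 1)
     + (of_nat (b 0) - of_nat (b (D x y)) - of_nat (c (D x y))) * m (D x y)"
proof -
  define N where "N = {w \<in> X. (x, w) \<in> R}"
  define F where "F = {w \<in> X. (x, w) \<in> R \<and> D y w = D y x + 1}"
  define B where "B = {w \<in> X. (x, w) \<in> R \<and> D y w + 1 = D y x}"
  define C where "C = N - (F \<union> B)"
  have fin: "finite N" "finite F" "finite B" "finite C"
    by (auto simp: N_def F_def B_def C_def)
  have dis: "F \<inter> B = {}" "(F \<union> B) \<inter> C = {}" "N = F \<union> B \<union> C"
    by (auto simp: N_def F_def B_def C_def)
  \<comment> \<open>Seen from \<open>x\<close> itself every neighbour lies forward, so the valency
    is \<open>b 0\<close>.\<close>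
  have "N = {w \<in> X. (x, w) \<in> R \<and> D x w = D x x + 1}"
    using D_eq_1_iff assms by (auto simp: N_def)
  then have cN: "card N = b 0" using card_forward[OF assms(1,1)] by simp
  have cF: "card F = b (D x y)" and cB: "card B = c (D x y)"
    using card_forward[OF assms(2,1)] card_backward[OF assms(2,1)] D_sym[OF assms]
    by (auto simp: F_def B_def)
  have "card N = card F + card B + card C"
    using fin dis by (simp add: card_Un_disjoint)
  then have cC: "of_nat (card C) = (of_nat (b 0) - of_nat (b (D x y)) - of_nat (c (D x y)) :: complex)"
    using cN cF cB by simp
  have "(\<Sum>w\<in>N. m (D w y)) = (\<Sum>w\<in>F. m (D w y)) + (\<Sum>w\<in>B. m (D w y)) + (\<Sum>w\<in>C. m (D w y))"
    using fin dis by (simp add: sum.union_disjoint)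
  moreover have "(\<Sum>w\<in>F. m (D w y)) = (\<Sum>w\<in>F. m (D x y + 1))"
    using D_sym assms by (intro sum.cong) (auto simp: F_def)
  moreover have "(\<Sum>w\<in>B. m (D w y)) = (\<Sum>w\<in>B. m (D x y - 1))"
  proof (intro sum.cong refl)
    fix w assume "w \<in> B"
    then have "w \<in> X" "D w y + 1 = D x y" using D_sym assms by (auto simp: B_def)
    then show "m (D w y) = m (D x y - 1)" by (metis add_diff_cancel_right')
  qed
  moreover have "(\<Sum>w\<in>C. m (D w y)) = (\<Sum>w\<in>C. m (D x y))"
  proof (intro sum.cong refl)
    fix w assume "w \<in> C"
    then have w: "w \<in> X" "(x, w) \<in> R" "D y w \<noteq> D y x + 1" "D y w + 1 \<noteq> D y x"
      by (auto simp: C_def N_def F_def B_def)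
    then have "D y w = D y x" using D_adjacent[OF assms(2) w(2)] by linarith
    then show "m (D w y) = m (D x y)" using D_sym assms w by metis
  qed
  ultimately show ?thesis using cF cB cC by (simp add: N_def)
qed

text \<open>The recursion A_1 A_(k+1) = b_k A_k + a_(k+1) A_(k+1) + c_(k+2) A_(k+2) can be solved
  for its last matrix because \<open>c_pos\<close> makes the coefficient nonzero. Hence closure
  under multiplication by A_1, which is \<open>sum_neighbours\<close>, extends to every A_n.\<close>

lemma sum_sphere_radial:
  fixes m :: "nat \<Rightarrow> complex"
  assumes "n \<le> d"
  shows "\<exists>m'. \<forall>x\<in>X. \<forall>y\<in>X. (\<Sum>z\<in>X. if D x z = n then m (D z y) else 0) = m' (D x y)"
  using assms
proof (induction n rule: less_induct)
  case (less n)
  let ?T = "\<lambda>n x y. \<Sum>z\<in>X. if D x z = n then m (D z y) else (0::complex)"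
  consider "n = 0" | "n = 1" | k where "n = Suc (Suc k)"
    by (metis One_nat_def not0_implies_Suc)
  then show ?case
  proof cases
    case 1
    have "?T n x y = m (D x y)" if "x \<in> X" "y \<in> X" for x y
    proof -
      have "?T n x y = (\<Sum>z\<in>X. if z = x then m (D z y) else 0)"
        using that D_eq_0_iff 1 by (intro sum.cong) auto
      then show ?thesis using that by simp
    qed
    then show ?thesis by blast
  next
    case 2
    have "?T n x y = (\<Sum>w\<in>{w \<in> X. (x, w) \<in> R}. m (D w y))" if "x \<in> X" "y \<in> X" for x y
      using that D_eq_1_iff 2 by (subst sum.inter_filter[symmetric]) (auto intro!: sum.cong)
    then show ?thesis using sum_neighbours
      by (intro exI[of _ "\<lambda>j. of_nat (b j) * m (j + 1) + of_nat (c j) * m (j - 1)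
     + (of_nat (b 0) - of_nat (b j) - of_nat (c j)) * m j"]) auto
  next
    case 3
    obtain m0 where m0: "\<And>x y. x \<in> X \<Longrightarrow> y \<in> X \<Longrightarrow> ?T k x y = m0 (D x y)"
      using less.IH[of k] less.prems 3 by auto
    obtain m1 where m1: "\<And>x y. x \<in> X \<Longrightarrow> y \<in> X \<Longrightarrow> ?T (Suc k) x y = m1 (D x y)"
      using less.IH[of "Suc k"] less.prems 3 by auto
    define a where "a = (of_nat (b 0) - of_nat (b (Suc k)) - of_nat (c (Suc k)) :: complex)"
    define G where "G j = of_nat (b j) * m1 (j + 1) + of_nat (c j) * m1 (j - 1)
     + (of_nat (b 0) - of_nat (b j) - of_nat (c j)) * m1 j" for j
    have cn: "of_nat (c n) \<noteq> (0::complex)" using c_pos[of "Suc k"] less.prems 3 by simp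
    have "?T n x y = (G (D x y) - of_nat (b k) * m0 (D x y) - a * m1 (D x y)) / of_nat (c n)"
      if xy: "x \<in> X" "y \<in> X" for x y
    proof -
      \<comment> \<open>This is the entry at \<open>x\<close>, \<open>y\<close> of A_1 A_(k+1)
        \<open>rad m\<close>, read first as A_1 times a radial matrix. After the swap the inner sum
        is an entry of A_1 A_(k+1), and the recursion applies to it.\<close>
      have "G (D x y) = (\<Sum>w\<in>{w \<in> X. (x, w) \<in> R}. m1 (D w y))"
        using sum_neighbours[OF xy, of m1] by (simp add: G_def)
      also have "\<dots> = (\<Sum>w\<in>{w \<in> X. (x, w) \<in> R}. ?T (Suc k) w y)"
        using m1 xy by (intro sum.cong) auto
      also have "\<dots> = (\<Sum>z\<in>X. \<Sum>w\<in>{w \<in> X. (x, w) \<in> R}. if D w z = Suc k then m (D z y) else 0)"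
        by (rule sum.swap)
      also have "\<dots> = (\<Sum>z\<in>X. (\<Sum>w\<in>{w \<in> X. (x, w) \<in> R}. if D w z = Suc k then 1 else 0) * m (D z y))"
        by (simp add: sum_distrib_right if_distrib[of "\<lambda>t. t * _"] cong: if_cong)
      also have "\<dots> = (\<Sum>z\<in>X. of_nat (b k) * (if D x z = k then m (D z y) else 0)
          + a * (if D x z = Suc k then m (D z y) else 0)
          + of_nat (c n) * (if D x z = n then m (D z y) else 0))"
      proof (intro sum.cong refl)
        fix z assume z: "z \<in> X"
        show "(\<Sum>w\<in>{w \<in> X. (x, w) \<in> R}. if D w z = Suc k then 1 else 0) * m (D z y)
          = of_nat (b k) * (if D x z = k then m (D z y) else 0)
          + a * (if D x z = Suc k then m (D z y) else 0)
          + of_nat (c n) * (if D x z = n then m (D z y) else 0)"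
          using sum_neighbours[OF xy(1) z, of "\<lambda>j. if j = Suc k then 1 else 0"] 3
          by (auto simp: a_def)
      qed
      also have "\<dots> = of_nat (b k) * ?T k x y + a * ?T (Suc k) x y + of_nat (c n) * ?T n x y"
        by (simp add: sum.distrib sum_distrib_left)
      finally show ?thesis using m0[OF xy] m1[OF xy] cn by (simp add: field_simps)
    qed
    then show ?thesis
      by (intro exI[of _ "\<lambda>j. (G j - of_nat (b k) * m0 j - a * m1 j) / of_nat (c n)"]) auto
  qed
qed

lemma rad_mult: "\<exists>m''. mat_mult X (rad m) (rad m') = rad m''"
proof -
  have "\<forall>n. \<exists>f. n \<le> d \<longrightarrow>
      (\<forall>x\<in>X. \<forall>y\<in>X. (\<Sum>z\<in>X. if D x z = n then m' (D z y) else 0) = f (D x y))"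
    using sum_sphere_radial[of _ m'] by simp
  from choice[OF this] obtain t where t: "\<And>n x y. n \<le> d \<Longrightarrow> x \<in> X \<Longrightarrow> y \<in> X \<Longrightarrow>
      (\<Sum>z\<in>X. if D x z = n then m' (D z y) else 0) = t n (D x y)"
    by auto
  have "mat_mult X (rad m) (rad m') x y = rad (\<lambda>j. \<Sum>n\<le>d. m n * t n j) x y" for x y
  proof (cases "x \<in> X \<and> y \<in> X")
    case True
    have "mat_mult X (rad m) (rad m') x y = (\<Sum>z\<in>X. m (D x z) * m' (D z y))"
      using True by (auto simp: mat_mult_def rad_def intro!: sum.cong)
    also have "\<dots> = (\<Sum>z\<in>X. \<Sum>n\<le>d. m n * (if D x z = n then m' (D z y) else 0))"
      using True D_le_d by (intro sum.cong) (auto simp: if_distrib[of "(*) _"] cong: if_cong)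
    also have "\<dots> = (\<Sum>n\<le>d. \<Sum>z\<in>X. m n * (if D x z = n then m' (D z y) else 0))"
      by (rule sum.swap)
    also have "\<dots> = (\<Sum>n\<le>d. m n * t n (D x y))"
      using t True by (simp add: sum_distrib_left[symmetric])
    finally show ?thesis using True by (simp add: rad_def)
  qed (auto simp: mat_mult_def rad_def)
  then show ?thesis by (intro exI[of _ "\<lambda>j. \<Sum>n\<le>d. m n * t n j"]) (simp add: fun_eq_iff)
qed

lemma rad_sym: "rad m x y = rad m y x"
  by (auto simp: rad_def D_sym)

lemma mat_mult_assoc: "mat_mult X (mat_mult X L M) N = mat_mult X L (mat_mult X M N)"
proof (intro ext)
  fix x y
  have "mat_mult X (mat_mult X L M) N x y = (\<Sum>w\<in>X. \<Sum>z\<in>X. L x z * M z w * N w y)"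
    by (simp add: mat_mult_def sum_distrib_right)
  also have "\<dots> = (\<Sum>z\<in>X. \<Sum>w\<in>X. L x z * M z w * N w y)"
    by (rule sum.swap)
  also have "\<dots> = mat_mult X L (mat_mult X M N) x y"
    by (simp add: mat_mult_def sum_distrib_left mult.assoc)
  finally show "mat_mult X (mat_mult X L M) N x y = mat_mult X L (mat_mult X M N) x y" .
qed

lemma bose_mesner_mult:
  assumes "M \<in> bose_mesner X R" "N \<in> bose_mesner X R"
  shows "mat_mult X M N \<in> bose_mesner X R"
proof -
  obtain m n where "M = rad m" "N = rad n" using assms unfolding bose_mesner_iff by blast
  moreover obtain p where "mat_mult X (rad m) (rad n) = rad p" using rad_mult by blast
  ultimately have "mat_mult X M N = rad p" by (simp only:)
  then show ?thesis unfolding bose_mesner_iff by (intro exI)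
qed

lemma bose_mesner_sym:
  assumes "M \<in> bose_mesner X R"
  shows "M x y = M y x"
proof -
  obtain m where "M = rad m" using assms unfolding bose_mesner_iff by blast
  then show ?thesis using rad_sym[of m x y] by (simp only:)
qed

text \<open>The product \<open>M N\<close> again lies in the algebra and is therefore symmetric, so
  it equals its transpose \<open>N M\<close>.\<close>

lemma bose_mesner_commute:
  assumes "M \<in> bose_mesner X R" "N \<in> bose_mesner X R"
  shows "mat_mult X M N = mat_mult X N M"
proof (intro ext)
  fix x y
  have "mat_mult X M N x y = mat_mult X M N y x"
    by (rule bose_mesner_sym[OF bose_mesner_mult[OF assms]])
  also have "\<dots> = (\<Sum>z\<in>X. N x z * M z y)"
    unfolding mat_mult_def
    by (intro sum.cong refl)
      (metis bose_mesner_sym[OF assms(1)] bose_mesner_sym[OF assms(2)] mult.commute)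
  finally show "mat_mult X M N x y = mat_mult X N M x y" by (simp add: mat_mult_def)
qed

lemma bose_mesner_diff:
  assumes "M \<in> bose_mesner X R" "N \<in> bose_mesner X R"
  shows "(\<lambda>x y. M x y - N x y) \<in> bose_mesner X R"
proof -
  obtain m n where "M = rad m" "N = rad n" using assms unfolding bose_mesner_iff by blast
  then have "(\<lambda>x y. M x y - N x y) = rad (\<lambda>j. m j - n j)"
    by (auto simp: rad_def fun_eq_iff)
  then show ?thesis unfolding bose_mesner_iff by blast
qed

lemma bose_mesner_cnj:
  assumes "M \<in> bose_mesner X R"
  shows "(\<lambda>x y. cnj (M x y)) \<in> bose_mesner X R"
proof -
  obtain m where "M = rad m" using assms unfolding bose_mesner_iff by blast
  then have "(\<lambda>x y. cnj (M x y)) = rad (\<lambda>j. cnj (m j))"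
    by (auto simp: rad_def fun_eq_iff)
  then show ?thesis unfolding bose_mesner_iff by blast
qed

section \<open>Primitive idempotents: orthogonality and real entries\<close>

text \<open>\<open>P = P F + (P - P F)\<close> splits \<open>P\<close> into two orthogonal
  idempotents, so primitivity kills one of them.\<close>

lemma primitive_idempotent_mult:
  assumes P: "P \<in> primitive_idempotents X R" and F: "F \<in> idempotents X R"
  shows "mat_mult X P F = zero_mat \<or> mat_mult X P F = P"
proof -
  let ?G = "mat_mult X P F"
  let ?H = "\<lambda>x y. P x y - ?G x y"
  have Pi: "P \<in> bose_mesner X R" "mat_mult X P P = P"
    and Fi: "F \<in> bose_mesner X R" "mat_mult X F F = F"
    using P F by (auto simp: primitive_idempotents_def idempotents_def)
  have PG: "mat_mult X P ?G = ?G" using Pi by (simp add: mat_mult_assoc[symmetric])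
  have G: "?G \<in> bose_mesner X R" using bose_mesner_mult Pi Fi by blast
  have GP: "mat_mult X ?G P = ?G" using PG bose_mesner_commute[OF G Pi(1)] by simp
  have "mat_mult X ?G ?G = mat_mult X (mat_mult X ?G P) F" by (simp add: mat_mult_assoc)
  also have "\<dots> = ?G" using GP Fi by (simp add: mat_mult_assoc)
  finally have GG: "mat_mult X ?G ?G = ?G" .
  have diff_right: "mat_mult X M ?H = (\<lambda>x y. mat_mult X M P x y - mat_mult X M ?G x y)" for M
    by (simp add: mat_mult_def[of X M] right_diff_distrib sum_subtractf)
  have diff_left: "mat_mult X ?H M = (\<lambda>x y. mat_mult X P M x y - mat_mult X ?G M x y)" for M
    unfolding mat_mult_def[of X _ M] by (simp add: left_diff_distrib sum_subtractf)
  have "?G \<in> idempotents X R" using G GG by (simp add: idempotents_def)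
  moreover have "mat_mult X ?H ?H = ?H"
    unfolding diff_left diff_right by (simp add: PG GP GG Pi)
  then have "?H \<in> idempotents X R"
    using bose_mesner_diff[OF Pi(1) G] by (simp add: idempotents_def)
  moreover have "mat_mult X ?G ?H = zero_mat" "mat_mult X ?H ?G = zero_mat"
    unfolding diff_left diff_right by (simp_all add: PG GP GG zero_mat_def)
  moreover have "P = (\<lambda>x y. ?G x y + ?H x y)" by simp
  ultimately have "?G = zero_mat \<or> ?H = zero_mat"
    using P unfolding primitive_idempotents_def by blast
  then show ?thesis by (auto simp: zero_mat_def fun_eq_iff)
qed

text \<open>A nonzero product would equal both \<open>P\<close> and \<open>Q\<close>, because the
  two commute.\<close>

lemma primitive_idempotents_orthogonal:
  assumes P: "P \<in> primitive_idempotents X R" and Q: "Q \<in> primitive_idempotents X R" and "P \<noteq> Q"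
  shows "mat_mult X P Q = zero_mat"
proof -
  have i: "P \<in> idempotents X R" "Q \<in> idempotents X R"
    using P Q by (auto simp: primitive_idempotents_def)
  then have "mat_mult X P Q = mat_mult X Q P"
    by (intro bose_mesner_commute) (auto simp: idempotents_def)
  then show ?thesis
    using primitive_idempotent_mult[OF P i(2)] primitive_idempotent_mult[OF Q i(1)] assms(3) by auto
qed

lemma bose_mesner_nonzero:
  assumes "M \<in> bose_mesner X R" "M \<noteq> zero_mat"
  obtains x y where "x \<in> X" "y \<in> X" "M x y \<noteq> 0"
proof -
  obtain m where m: "M = rad m" using assms(1) unfolding bose_mesner_iff by blast
  obtain x y where xy: "M x y \<noteq> 0" using assms(2) by (auto simp: zero_mat_def fun_eq_iff)
  then have "x \<in> X \<and> y \<in> X" unfolding m rad_def by presburger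
  then show ?thesis using that xy by blast
qed

text \<open>The product of \<open>P\<close> and its conjugate is \<open>P P\<^sup>*\<close>, which is nonzero and hence equal to \<open>P\<close>
  by primitivity.\<close>

lemma primitive_idempotent_real:
  assumes P: "P \<in> primitive_idempotents X R"
  shows "cnj (P x y) = P x y"
proof -
  let ?F = "\<lambda>x y. cnj (P x y)"
  have Pi: "P \<in> bose_mesner X R" "mat_mult X P P = P" "P \<noteq> zero_mat"
    using P by (auto simp: primitive_idempotents_def idempotents_def)
  have F: "?F \<in> bose_mesner X R" using bose_mesner_cnj Pi by auto
  have cnj_mult: "mat_mult X ?F (\<lambda>x y. cnj (M x y)) = (\<lambda>x y. cnj (mat_mult X P M x y))" for M
    by (simp add: mat_mult_def)
  have "?F \<in> idempotents X R" using F Pi by (simp add: idempotents_def cnj_mult)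
  then have "mat_mult X P ?F = zero_mat \<or> mat_mult X P ?F = P"
    by (rule primitive_idempotent_mult[OF P])
  moreover have "mat_mult X P ?F \<noteq> zero_mat"
  proof
    assume *: "mat_mult X P ?F = zero_mat"
    obtain x y where xy: "x \<in> X" "y \<in> X" "P x y \<noteq> 0"
      using bose_mesner_nonzero[OF Pi(1,3)] .
    have "mat_mult X P ?F x x = of_real (\<Sum>z\<in>X. (cmod (P x z))\<^sup>2)"
      using bose_mesner_sym[OF Pi(1)]
      by (simp add: mat_mult_def complex_norm_square[symmetric] flip: of_real_power)
    then have "(\<Sum>z\<in>X. (cmod (P x z))\<^sup>2) = 0" using * by (simp add: zero_mat_def flip: of_real_power of_real_sum)
    then show False using xy by (simp add: sum_nonneg_eq_0_iff)
  qed
  ultimately have PF: "mat_mult X P ?F = P" by auto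
  \<comment> \<open>Conjugating \<open>P ?F = P\<close> gives \<open>?F P = ?F\<close>, and the two
    products agree by commutativity.\<close>
  have "?F = mat_mult X ?F (\<lambda>x y. cnj (?F x y))" unfolding cnj_mult by (simp add: PF)
  also have "\<dots> = mat_mult X P ?F" using bose_mesner_commute[OF F Pi(1)] by simp
  also note PF
  finally have "?F = P" .
  then show ?thesis by (rule fun_cong[OF fun_cong])
qed

end

section \<open>Polynomial structure of the idempotents\<close>

text \<open>Newton's form: at a new node the polynomial is corrected by a multiple of
  \<open>w\<close>, which vanishes at all old nodes.\<close>

lemma lagrange_interpolation:
  fixes t g :: "'b \<Rightarrow> 'c::field"
  assumes "finite S" "inj_on t S"
  shows "\<exists>p. degree p \<le> card S - 1 \<and> (\<forall>j\<in>S. poly p (t j) = g j)"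
  using assms
proof (induction S rule: finite_induct)
  case empty
  then show ?case by (auto intro: exI[of _ 0])
next
  case (insert s S)
  then obtain p where p: "degree p \<le> card S - 1" "\<forall>j\<in>S. poly p (t j) = g j" by auto
  define w where "w = (\<Prod>j\<in>S. [:- t j, 1:])"
  have w_eq: "poly w y = (\<Prod>j\<in>S. y - t j)" for y
    by (simp add: w_def poly_prod)
  have w0: "poly w (t s) \<noteq> 0"
    using insert by (auto simp: w_eq inj_on_def)
  have w1: "poly w (t j) = 0" if "j \<in> S" for j
    using that insert by (auto simp: w_eq intro!: prod_zero)
  have "degree w \<le> card S"
    unfolding w_def using degree_prod_sum_le[OF insert(1), of "\<lambda>j. [:- t j, 1:]"] by (simp add: o_def)
  then have "degree (p + smult ((g s - poly p (t s)) / poly w (t s)) w) \<le> card S"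
    using p(1) by (intro degree_add_le) (auto intro: order.trans degree_smult_le)
  then show ?case using insert p w0 w1
    by (intro exI[of _ "p + smult ((g s - poly p (t s)) / poly w (t s)) w"]) auto
qed

text \<open>The dual scalars are fixed as parameters. Injectivity of \<theta> is an assumption here
  and is derived from the classical parameters in the final theorem.\<close>

locale q_polynomial_graph = distance_regular_graph +
  fixes E :: "nat \<Rightarrow> 'a cmat" and \<theta> as bs cs :: "nat \<Rightarrow> complex"
  assumes ordering: "idempotent_ordering X R E"
    and cs_nonzero: "i \<in> {1..d} \<Longrightarrow> bs (i - 1) * cs i \<noteq> 0"
    and three_term: "i \<le> d \<Longrightarrow> E 1 x y * E i x y =
           ((if i = 0 then 0 else bs (i - 1) * E (i - 1) x y) + as i * E i x y
             + (if i = d then 0 else cs (i + 1) * E (i + 1) x y)) / of_nat (card X)"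
    and dual: "dual_eigenvalues X R E \<theta>"
    and inj_\<theta>: "inj_on \<theta> {..d}"
begin

abbreviation N :: complex where
  "N \<equiv> of_nat (card X)"

lemma N_nonzero [simp]: "N \<noteq> 0"
  using X_nonempty by simp

lemma E_primitive: "k \<le> d \<Longrightarrow> E k \<in> primitive_idempotents X R"
  using ordering diameter by (auto simp: idempotent_ordering_def dest: bij_betwE)

lemma E_bose_mesner: "k \<le> d \<Longrightarrow> E k \<in> bose_mesner X R"
  using E_primitive by (auto simp: primitive_idempotents_def idempotents_def)

lemma E_sym: "k \<le> d \<Longrightarrow> E k x y = E k y x"
  by (intro bose_mesner_sym E_bose_mesner)

lemma E_real: "k \<le> d \<Longrightarrow> cnj (E k x y) = E k x y"
  by (intro primitive_idempotent_real E_primitive)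

lemma E_0: "x \<in> X \<Longrightarrow> y \<in> X \<Longrightarrow> E 0 x y = 1 / N"
  using ordering by (simp add: idempotent_ordering_def all_ones_def)

lemma E_mult:
  assumes "k \<le> d" "l \<le> d"
  shows "(\<Sum>z\<in>X. E k x z * E l z y) = (if k = l then E k x y else 0)"
proof (cases "k = l")
  case True
  have "mat_mult X (E k) (E k) = E k"
    using E_primitive[OF assms(1)] by (simp add: primitive_idempotents_def idempotents_def)
  then show ?thesis using True by (simp add: mat_mult_def fun_eq_iff)
next
  case False
  have "inj_on E {0..d}" using ordering diameter by (auto simp: idempotent_ordering_def bij_betw_def)
  then have "E k \<noteq> E l" using assms False by (auto simp: inj_on_def)
  then have "mat_mult X (E k) (E l) = zero_mat"
    by (intro primitive_idempotents_orthogonal E_primitive assms)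
  then show ?thesis using False by (simp add: mat_mult_def zero_mat_def fun_eq_iff)
qed

lemma E_nonzero:
  assumes "k \<le> d"
  obtains x y where "x \<in> X" "y \<in> X" "E k x y \<noteq> 0"
  using bose_mesner_nonzero[OF E_bose_mesner[OF assms]] E_primitive[OF assms]
  by (auto simp: primitive_idempotents_def)

lemma E_1_eq:
  assumes "x \<in> X" "y \<in> X"
  shows "N * E 1 x y = \<theta> (D x y)"
proof -
  have "N * E 1 x y = (\<Sum>i\<le>d. \<theta> i * distance_matrix X R i x y)"
    using dual diameter by (simp add: dual_eigenvalues_def)
  also have "\<dots> = \<theta> (D x y)"
    using assms D_le_d by (simp add: distance_matrix_def if_distrib[of "(*) _"] cong: if_cong)
  finally show ?thesis .
qed

lemma \<theta>_mult_E:
  assumes "i \<le> d" "x \<in> X" "y \<in> X"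
  shows "\<theta> (D x y) * E i x y = (if i = 0 then 0 else bs (i - 1) * E (i - 1) x y) + as i * E i x y
             + (if i = d then 0 else cs (i + 1) * E (i + 1) x y)"
proof -
  have "\<theta> (D x y) * E i x y = N * (E 1 x y * E i x y)"
    unfolding E_1_eq[OF assms(2,3), symmetric] by (rule mult.assoc)
  then show ?thesis unfolding three_term[OF assms(1)] by simp
qed

text \<open>The three-term recurrence is solved for its top idempotent, whose coefficient
  \<open>cs k\<close> is nonzero; each step costs one factor \<theta>.\<close>

lemma E_poly:
  "k \<le> d \<Longrightarrow> \<exists>p. degree p \<le> k \<and> (\<forall>x\<in>X. \<forall>y\<in>X. E k x y = poly p (\<theta> (D x y)))"
proof (induction k rule: less_induct)
  case (less k)
  show ?case
  proof (cases k)
    case 0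
    then show ?thesis using E_0 by (intro exI[of _ "[:1 / N:]"]) auto
  next
    case (Suc i)
    obtain p where p: "degree p \<le> i" "\<And>x y. x \<in> X \<Longrightarrow> y \<in> X \<Longrightarrow> E i x y = poly p (\<theta> (D x y))"
      using less.IH[of i] less.prems Suc by auto
    obtain r where r: "degree r \<le> i - 1" "\<And>x y. x \<in> X \<Longrightarrow> y \<in> X \<Longrightarrow> E (i - 1) x y = poly r (\<theta> (D x y))"
      using less.IH[of "i - 1"] less.prems Suc by (metis diff_le_self le_imp_less_Suc le_less_trans less_imp_le_nat not_le)
    \<comment> \<open>For \<open>i = 0\<close> the truncated index makes \<open>r\<close> describe
      \<open>E 0\<close>; \<open>s\<close> discards it, as the recurrence has no lower term
      there.\<close>
    define s where "s = (if i = 0 then 0 else smult (bs (i - 1)) r)"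
    define v where "v = smult (1 / cs k) ([:- as i, 1:] * p - s)"
    have "degree ([:- as i, 1:] * p) \<le> k"
      using degree_mult_le[of "[:- as i, 1:]" p] p(1) Suc by simp
    moreover have "degree s \<le> k"
      using r(1) degree_smult_le[of "bs (i - 1)" r] Suc by (auto simp: s_def)
    ultimately have "degree v \<le> k"
      unfolding v_def by (intro order.trans[OF degree_smult_le] degree_diff_le)
    moreover have "E k x y = poly v (\<theta> (D x y))" if xy: "x \<in> X" "y \<in> X" for x y
    proof -
      have "cs k \<noteq> 0" using cs_nonzero[of k] less.prems Suc by auto
      moreover have "\<theta> (D x y) * E i x y = poly s (\<theta> (D x y)) + as i * E i x y + cs k * E k x y"
        using \<theta>_mult_E[of i x y] xy r(2)[OF xy] less.prems Suc by (auto simp: s_def)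
      ultimately show ?thesis using p(2)[OF xy] by (simp add: v_def field_simps)
    qed
    ultimately show ?thesis by blast
  qed
qed

section \<open>Spans of the first idempotents and polynomials in \<theta>\<close>

definition in_span :: "nat \<Rightarrow> 'a cmat \<Rightarrow> bool" where
  "in_span m F \<longleftrightarrow> (\<exists>a. \<forall>x\<in>X. \<forall>y\<in>X. F x y = (\<Sum>k\<le>m. a k * E k x y))"

lemma in_span_E: "k \<le> m \<Longrightarrow> in_span m (E k)"
  unfolding in_span_def
  by (intro exI[of _ "\<lambda>i. if i = k then 1 else 0"]) (simp add: if_distrib[of "\<lambda>t. t * _"] cong: if_cong)

lemma in_span_zero: "in_span m (\<lambda>x y. 0)"
  unfolding in_span_def by (intro exI[of _ "\<lambda>i. 0"]) simp

lemma in_span_add: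
  assumes "in_span m F" "in_span m G"
  shows "in_span m (\<lambda>x y. F x y + G x y)"
proof -
  obtain f g where "\<forall>x\<in>X. \<forall>y\<in>X. F x y = (\<Sum>k\<le>m. f k * E k x y)"
    "\<forall>x\<in>X. \<forall>y\<in>X. G x y = (\<Sum>k\<le>m. g k * E k x y)"
    using assms unfolding in_span_def by blast
  then show ?thesis unfolding in_span_def
    by (intro exI[of _ "\<lambda>i. f i + g i"]) (simp add: distrib_right sum.distrib)
qed

lemma in_span_scale:
  assumes "in_span m F"
  shows "in_span m (\<lambda>x y. s * F x y)"
proof -
  obtain f where "\<forall>x\<in>X. \<forall>y\<in>X. F x y = (\<Sum>k\<le>m. f k * E k x y)"
    using assms unfolding in_span_def by blast
  then show ?thesis unfolding in_span_def
    by (intro exI[of _ "\<lambda>i. s * f i"]) (simp add: sum_distrib_left mult.assoc)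
qed

lemma in_span_sum:
  assumes "finite I" "\<And>i. i \<in> I \<Longrightarrow> in_span m (F i)"
  shows "in_span m (\<lambda>x y. \<Sum>i\<in>I. F i x y)"
  using assms by (induction I rule: finite_induct) (auto intro: in_span_zero in_span_add)

lemma in_span_cong:
  "in_span m F \<Longrightarrow> (\<And>x y. x \<in> X \<Longrightarrow> y \<in> X \<Longrightarrow> F x y = G x y) \<Longrightarrow> in_span m G"
  unfolding in_span_def by simp

text \<open>Horner's scheme: writing \<open>p\<close> as a constant plus \<theta> times
  \<open>r\<close>, the recurrence shows that multiplication by \<theta> raises the level by at most
  one. This is the converse of \<open>E_poly\<close>.\<close>

lemma in_span_poly:
  "degree p \<le> m \<Longrightarrow> m \<le> d \<Longrightarrow> in_span m (\<lambda>x y. poly p (\<theta> (D x y)))"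
proof (induction m arbitrary: p)
  case 0
  then obtain c where "p = [:c:]" by (auto elim: degree_eq_zeroE)
  then show ?case using E_0
    by (intro in_span_cong[OF in_span_scale[OF in_span_E[of 0 0], of "c * N"]]) auto
next
  case (Suc m)
  obtain c r where p: "p = pCons c r" by (cases p)
  then have "degree r \<le> m" using Suc.prems(1) by (cases "r = 0") auto
  then obtain a where a: "\<forall>x\<in>X. \<forall>y\<in>X. poly r (\<theta> (D x y)) = (\<Sum>k\<le>m. a k * E k x y)"
    using Suc unfolding in_span_def by (metis Suc_leD)
  \<comment> \<open>The right-hand side of the recurrence without its case \<open>k = d\<close>,
    which cannot occur since \<open>k \<le> m < d\<close>.\<close>
  let ?G = "\<lambda>k x y. bs (k - 1) * (if k = 0 then 0 else E (k - 1) x y) + as k * E k x y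
      + cs (k + 1) * E (k + 1) x y"
  have G: "in_span (Suc m) (?G k)" if "k \<le> m" for k
    using that by (cases "k = 0") (auto intro!: in_span_add in_span_scale in_span_E in_span_zero)
  have "in_span (Suc m) (\<lambda>x y. c * N * E 0 x y + (\<Sum>k\<le>m. a k * ?G k x y))"
    by (rule in_span_add[OF in_span_scale[OF in_span_E] in_span_sum[OF _ in_span_scale[OF G]]]) auto
  then show ?case
  proof (rule in_span_cong)
    fix x y assume xy: "x \<in> X" "y \<in> X"
    have "poly p (\<theta> (D x y)) = c + (\<Sum>k\<le>m. a k * (\<theta> (D x y) * E k x y))"
      using a xy by (simp add: p sum_distrib_left algebra_simps)
    also have "\<dots> = c + (\<Sum>k\<le>m. a k * ?G k x y)"
      using \<theta>_mult_E xy Suc.prems(2) by (intro arg_cong2[of _ _ _ _ "(+)"] sum.cong) auto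
    finally show "c * N * E 0 x y + (\<Sum>k\<le>m. a k * ?G k x y) = poly p (\<theta> (D x y))"
      using E_0 xy by simp
  qed
qed

text \<open>Interpolation at the \<open>d + 1\<close> distinct values of \<theta> turns any function
  of the distance into a polynomial in \<theta>. So the \<open>E k\<close> span the Bose-Mesner
  algebra.\<close>

lemma in_span_radial: "in_span d (\<lambda>x y. g (D x y))"
proof -
  obtain p where "degree p \<le> d" "\<forall>j\<le>d. poly p (\<theta> j) = g j"
    using lagrange_interpolation[OF _ inj_\<theta>, of g] by auto
  then show ?thesis using D_le_d by (intro in_span_cong[OF in_span_poly[of p d]]) auto
qed

text \<open>The identity matrix is radial, hence a combination of the \<open>E k\<close>;
  multiplying by \<open>E l\<close> shows that each coefficient is 1.\<close>

lemma sum_E: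
  assumes xy: "x \<in> X" "y \<in> X"
  shows "(\<Sum>k\<le>d. E k x y) = (if x = y then 1 else 0)"
proof -
  obtain a where a: "\<And>x y. x \<in> X \<Longrightarrow> y \<in> X \<Longrightarrow>
      (if D x y = 0 then 1 else 0) = (\<Sum>k\<le>d. a k * E k x y)"
    using in_span_radial[of "\<lambda>j. if j = 0 then 1 else 0"] unfolding in_span_def by blast
  have "a l = 1" if l: "l \<le> d" for l
  proof -
    obtain u v where uv: "u \<in> X" "v \<in> X" "E l u v \<noteq> 0" using E_nonzero[OF l] .
    have "E l u v = (\<Sum>z\<in>X. E l u z * (if D z v = 0 then 1 else 0))"
    proof -
      have "(\<Sum>z\<in>X. E l u z * (if D z v = 0 then 1 else 0)) = (\<Sum>z\<in>X. if z = v then E l u z else 0)"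
        using D_eq_0_iff uv by (intro sum.cong) auto
      then show ?thesis using uv by simp
    qed
    also have "\<dots> = (\<Sum>z\<in>X. \<Sum>k\<le>d. a k * (E l u z * E k z v))"
      using a uv by (intro sum.cong) (auto simp: sum_distrib_left algebra_simps)
    also have "\<dots> = (\<Sum>k\<le>d. a k * (\<Sum>z\<in>X. E l u z * E k z v))"
      by (subst sum.swap) (simp add: sum_distrib_left)
    also have "\<dots> = (\<Sum>k\<le>d. if k = l then a k * E l u v else 0)"
      using E_mult[OF l] by (intro sum.cong) auto
    also have "\<dots> = a l * E l u v" using l by simp
    finally show ?thesis using uv by simp
  qed
  then show ?thesis using a[OF xy] D_eq_0_iff[OF xy] by simp
qed

text \<open>By the three-term recurrence, two consecutive zeros in the sequence \<open>E k x y\<close> would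
  propagate down to \<open>E 0 x y\<close>.\<close>

lemma E_d_nonzero:
  assumes xy: "x \<in> X" "y \<in> X"
  shows "E d x y \<noteq> 0"
proof
  assume 0: "E d x y = 0"
  \<comment> \<open>The alternative \<open>k = 0\<close> stands for the convention that the
    idempotent of index \<open>d + 1\<close> is zero.\<close>
  have "E (d - k) x y = 0 \<and> (k = 0 \<or> E (Suc (d - k)) x y = 0)" if "k \<le> d" for k
    using that
  proof (induction k)
    case (Suc k)
    define i where "i = d - k"
    have i: "i \<le> d" "i > 0" "d - Suc k = i - 1" using Suc.prems by (auto simp: i_def)
    have "E i x y = 0" "i = d \<or> E (Suc i) x y = 0" using Suc by (auto simp: i_def)
    then have "bs (i - 1) * E (i - 1) x y = 0" using \<theta>_mult_E[OF i(1) xy] i by (auto split: if_splits)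
    then show ?case using cs_nonzero[of i] i \<open>E i x y = 0\<close> by auto
  qed (use 0 in auto)
  from this[of d] show False using E_0[OF xy] by simp
qed

subsection \<open>The degree filtration on functions\<close>

definition proj :: "nat \<Rightarrow> ('a \<Rightarrow> complex) \<Rightarrow> 'a \<Rightarrow> complex" where
  "proj k f x = (\<Sum>z\<in>X. E k x z * f z)"

definition deg_le :: "nat \<Rightarrow> ('a \<Rightarrow> complex) \<Rightarrow> bool" where
  "deg_le m f \<longleftrightarrow> (\<forall>k. m < k \<and> k \<le> d \<longrightarrow> (\<forall>x\<in>X. proj k f x = 0))"

lemma proj_add: "proj k (\<lambda>z. f z + g z) x = proj k f x + proj k g x"
  by (simp add: proj_def sum.distrib distrib_left)

lemma proj_scale: "proj k (\<lambda>z. s * f z) x = s * proj k f x"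
  by (simp add: proj_def sum_distrib_left algebra_simps)

lemma proj_sum: "proj k (\<lambda>z. \<Sum>i\<in>I. f i z) x = (\<Sum>i\<in>I. proj k (f i) x)"
  unfolding proj_def sum_distrib_left by (rule sum.swap)

lemma proj_cong: "(\<And>z. z \<in> X \<Longrightarrow> f z = g z) \<Longrightarrow> proj k f x = proj k g x"
  unfolding proj_def by (intro sum.cong) auto

lemma deg_le_sum: "(\<And>i. i \<in> I \<Longrightarrow> deg_le m (f i)) \<Longrightarrow> deg_le m (\<lambda>z. \<Sum>i\<in>I. f i z)"
  by (auto simp: deg_le_def proj_sum)

lemma deg_le_diff: "deg_le m f \<Longrightarrow> deg_le m g \<Longrightarrow> deg_le m (\<lambda>z. f z - g z)"
  using proj_add[of _ f "\<lambda>z. (-1) * g z"] proj_scale[of _ "-1" g] by (auto simp: deg_le_def)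

lemma sum_proj:
  assumes "x \<in> X"
  shows "(\<Sum>k\<le>d. proj k f x) = f x"
proof -
  have "(\<Sum>k\<le>d. proj k f x) = (\<Sum>z\<in>X. (\<Sum>k\<le>d. E k x z) * f z)"
    unfolding proj_def sum_distrib_right by (rule sum.swap)
  also have "\<dots> = (\<Sum>z\<in>X. if z = x then f z else 0)"
    using sum_E assms by (intro sum.cong) auto
  finally show ?thesis using assms by simp
qed

lemma deg_le_E:
  assumes "k \<le> d" "x \<in> X"
  shows "deg_le k (E k x)"
  unfolding deg_le_def proj_def
proof (intro allI impI ballI)
  fix l y assume l: "k < l \<and> l \<le> d" and "y \<in> X"
  have "(\<Sum>z\<in>X. E l y z * E k x z) = (\<Sum>z\<in>X. E l y z * E k z x)"
    using E_sym[OF assms(1)] by (intro sum.cong) auto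
  then show "(\<Sum>z\<in>X. E l y z * E k x z) = 0" using E_mult[of l k] l by auto
qed

lemma deg_le_poly:
  assumes "degree p \<le> m" "m \<le> d" "x \<in> X"
  shows "deg_le m (\<lambda>z. poly p (\<theta> (D x z)))"
proof -
  obtain a where a: "\<And>y. y \<in> X \<Longrightarrow> poly p (\<theta> (D x y)) = (\<Sum>k\<le>m. a k * E k x y)"
    using in_span_poly[OF assms(1,2)] assms(3) unfolding in_span_def by blast
  have "proj l (\<lambda>z. poly p (\<theta> (D x z))) y = 0" if l: "m < l" "l \<le> d" and y: "y \<in> X" for l y
  proof -
    have "proj l (\<lambda>z. poly p (\<theta> (D x z))) y = (\<Sum>k\<le>m. a k * proj l (E k x) y)"
      using proj_cong[OF a] by (simp add: proj_sum proj_scale)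
    also have "\<dots> = 0"
      using deg_le_E[OF _ assms(3)] l y assms(2) by (intro sum.neutral) (auto simp: deg_le_def)
    finally show ?thesis .
  qed
  then show ?thesis by (auto simp: deg_le_def)
qed

text \<open>The sum of the squared moduli of these triple sums is the trace of \<open>(E i \<circ> E j) E k\<close>, and
  \<open>E i \<circ> E j\<close> is a polynomial of degree at most \<open>i + j < k\<close> in \<open>\<theta>\<close>.\<close>

lemma triple_sum_zero:
  assumes ijk: "i + j < k" "k \<le> d" and abc: "a' \<in> X" "b' \<in> X" "c' \<in> X"
  shows "(\<Sum>z\<in>X. E i a' z * E j b' z * E k c' z) = 0"
proof -
  define t where "t u v w = (\<Sum>z\<in>X. E i u z * E j v z * E k w z)" for u v w
  have le: "i \<le> d" "j \<le> d" using ijk by auto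
  have t_real: "cnj (t u v w) = t u v w" for u v w
    using E_real le ijk by (simp add: t_def)
  obtain p where p: "degree p \<le> i" "\<And>x y. x \<in> X \<Longrightarrow> y \<in> X \<Longrightarrow> E i x y = poly p (\<theta> (D x y))"
    using E_poly[OF le(1)] by blast
  obtain r where r: "degree r \<le> j" "\<And>x y. x \<in> X \<Longrightarrow> y \<in> X \<Longrightarrow> E j x y = poly r (\<theta> (D x y))"
    using E_poly[OF le(2)] by blast
  have "degree (p * r) \<le> i + j" using p(1) r(1) degree_mult_le[of p r] by linarith
  then obtain s where s: "\<And>x y. x \<in> X \<Longrightarrow> y \<in> X \<Longrightarrow> E i x y * E j x y = (\<Sum>l\<le>i+j. s l * E l x y)"
    using in_span_poly[of "p * r" "i + j"] p(2) r(2) ijk unfolding in_span_def by force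
  have EE: "(\<Sum>u\<in>X. E l u z * E l u z') = E l z z'" if "l \<le> d" for l z z'
    using E_mult[OF that that, of z z'] E_sym[OF that] by simp
  have "(\<Sum>u\<in>X. \<Sum>v\<in>X. \<Sum>w\<in>X. t u v w * t u v w)
      = (\<Sum>u\<in>X. \<Sum>v\<in>X. \<Sum>w\<in>X. \<Sum>z\<in>X. \<Sum>z'\<in>X.
          (E i u z * E i u z') * ((E j v z * E j v z') * (E k w z * E k w z')))"
    by (simp add: t_def sum_product mult_ac)
  \<comment> \<open>The swaps move \<open>u\<close>, \<open>v\<close>, \<open>w\<close> innermost,
    where \<open>EE\<close> sums out each of them.\<close>
  also have "\<dots> = (\<Sum>u\<in>X. \<Sum>v\<in>X. \<Sum>z\<in>X. \<Sum>z'\<in>X. \<Sum>w\<in>X.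
          (E i u z * E i u z') * ((E j v z * E j v z') * (E k w z * E k w z')))"
    by (subst (1) sum.swap[of _ X X], subst (2) sum.swap[of _ X X]) simp
  also have "\<dots> = (\<Sum>u\<in>X. \<Sum>z\<in>X. \<Sum>z'\<in>X. \<Sum>v\<in>X. \<Sum>w\<in>X.
          (E i u z * E i u z') * ((E j v z * E j v z') * (E k w z * E k w z')))"
    by (subst (1) sum.swap[of _ X X], subst (2) sum.swap[of _ X X]) simp
  also have "\<dots> = (\<Sum>z\<in>X. \<Sum>z'\<in>X. \<Sum>u\<in>X. \<Sum>v\<in>X. \<Sum>w\<in>X.
          (E i u z * E i u z') * ((E j v z * E j v z') * (E k w z * E k w z')))"
    by (subst (1) sum.swap[of _ X X], subst (2) sum.swap[of _ X X]) simp
  also have "\<dots> = (\<Sum>z\<in>X. \<Sum>z'\<in>X. E i z z' * (E j z z' * E k z z'))"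
    using EE le ijk by (simp add: sum_distrib_left[symmetric] sum_distrib_right[symmetric])
  also have "\<dots> = (\<Sum>z\<in>X. \<Sum>z'\<in>X. \<Sum>l\<le>i+j. s l * (E l z z' * E k z' z))"
    using s E_sym[OF ijk(2)]
    by (intro sum.cong refl) (simp add: mult.assoc[symmetric] sum_distrib_right)
  also have "\<dots> = (\<Sum>z\<in>X. \<Sum>l\<le>i+j. s l * (\<Sum>z'\<in>X. E l z z' * E k z' z))"
    unfolding sum_distrib_left by (intro sum.cong refl sum.swap)
  also have "\<dots> = 0"
    using E_mult[OF _ ijk(2)] ijk by (intro sum.neutral ballI) auto
  finally have "(\<Sum>u\<in>X. \<Sum>v\<in>X. \<Sum>w\<in>X. t u v w * t u v w) = 0" .
  moreover have "t u v w * t u v w = of_real ((cmod (t u v w))\<^sup>2)" for u v w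
    using t_real complex_norm_square[of "t u v w"] by simp
  ultimately have "of_real (\<Sum>u\<in>X. \<Sum>v\<in>X. \<Sum>w\<in>X. (cmod (t u v w))\<^sup>2) = (0::complex)" by simp
  then have "(\<Sum>u\<in>X. \<Sum>v\<in>X. \<Sum>w\<in>X. (cmod (t u v w))\<^sup>2) = 0" by (simp only: of_real_eq_0_iff)
  then have "\<forall>u\<in>X. \<forall>v\<in>X. \<forall>w\<in>X. t u v w = 0"
    by (simp add: sum_nonneg_eq_0_iff sum_nonneg)
  then show ?thesis using abc by (simp add: t_def)
qed

text \<open>Split \<open>f\<close> and \<open>g\<close> into their components of levels
  \<open>p\<close> and \<open>r\<close>. Nonzero ones have \<open>p \<le> i\<close> and
  \<open>r \<le> j\<close>, and their contribution is a combination of triple sums with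
  \<open>p + r < k\<close>.\<close>

lemma proj_mult_zero:
  assumes f: "deg_le i f" and g: "deg_le j g" and k: "i + j < k" "k \<le> d" and a: "a' \<in> X"
  shows "proj k (\<lambda>z. f z * g z) a' = 0"
proof -
  have "(\<Sum>z\<in>X. E k a' z * (proj p f z * proj r g z)) = 0" if pr: "p \<le> d" "r \<le> d" for p r
  proof (cases "p \<le> i \<and> r \<le> j")
    case False
    then show ?thesis using f g pr by (intro sum.neutral) (auto simp: deg_le_def)
  next
    case True
    have "(\<Sum>z\<in>X. E k a' z * (proj p f z * proj r g z))
        = (\<Sum>z\<in>X. \<Sum>u\<in>X. \<Sum>v\<in>X. f u * (g v * (E p u z * E r v z * E k a' z)))"
      unfolding proj_def unfolding sum_product unfolding sum_distrib_left
      using E_sym[OF pr(1)] E_sym[OF pr(2)] by (intro sum.cong refl) (simp add: mult_ac)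
    also have "\<dots> = (\<Sum>u\<in>X. \<Sum>v\<in>X. \<Sum>z\<in>X. f u * (g v * (E p u z * E r v z * E k a' z)))"
      by (subst (1) sum.swap, subst (2) sum.swap) simp
    also have "\<dots> = (\<Sum>u\<in>X. \<Sum>v\<in>X. f u * (g v * (\<Sum>z\<in>X. E p u z * E r v z * E k a' z)))"
      by (simp add: sum_distrib_left)
    also have "\<dots> = 0"
      using triple_sum_zero[of p r k] True k a by (intro sum.neutral ballI) auto
    finally show ?thesis .
  qed
  then have "(\<Sum>p\<le>d. \<Sum>r\<le>d. \<Sum>z\<in>X. E k a' z * (proj p f z * proj r g z)) = 0"
    by (intro sum.neutral) auto
  moreover have "(\<Sum>p\<le>d. \<Sum>r\<le>d. \<Sum>z\<in>X. E k a' z * (proj p f z * proj r g z))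
      = (\<Sum>p\<le>d. \<Sum>z\<in>X. \<Sum>r\<le>d. E k a' z * (proj p f z * proj r g z))"
    by (intro sum.cong refl sum.swap)
  moreover have "\<dots> = (\<Sum>z\<in>X. \<Sum>p\<le>d. \<Sum>r\<le>d. E k a' z * (proj p f z * proj r g z))"
    by (rule sum.swap)
  moreover have "\<dots> = (\<Sum>z\<in>X. E k a' z * ((\<Sum>p\<le>d. proj p f z) * (\<Sum>r\<le>d. proj r g z)))"
    unfolding sum_product unfolding sum_distrib_left by (rule refl)
  ultimately show ?thesis using sum_proj by (simp add: proj_def[of k])
qed

lemma deg_le_mult: "deg_le i f \<Longrightarrow> deg_le j g \<Longrightarrow> deg_le (i + j) (\<lambda>z. f z * g z)"
  using proj_mult_zero unfolding deg_le_def by simp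

section \<open>Sums over spheres\<close>

text \<open>The \<open>j\<close>-th distance matrix acts on \<open>E k\<close> as a scalar, and
  comparing entries at \<open>y = x\<close> computes that scalar. The polynomial is the one from
  \<open>E_poly\<close>, normalised to take the value 1 at \<open>\<theta> 0\<close>; it serves all
  \<open>x\<close>, \<open>y\<close> and \<open>j\<close> at once.\<close>

lemma sphere_sum_E:
  assumes k: "k \<le> d"
  shows "\<exists>p. degree p \<le> k \<and> (\<forall>x\<in>X. \<forall>y\<in>X. \<forall>j\<le>d.
    (\<Sum>z\<in>sphere x j. E k z y) = of_nat (card (sphere x j)) * poly p (\<theta> j) * E k x y)"
proof -
  obtain p where p: "degree p \<le> k" "\<And>x y. x \<in> X \<Longrightarrow> y \<in> X \<Longrightarrow> E k x y = poly p (\<theta> (D x y))"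
    using E_poly[OF k] by blast
  \<comment> \<open>Otherwise the diagonal of \<open>E k\<close> would vanish, but a diagonal entry
    is the sum of the squared moduli of its row.\<close>
  have p0: "poly p (\<theta> 0) \<noteq> 0"
  proof
    assume 0: "poly p (\<theta> 0) = 0"
    obtain x y where xy: "x \<in> X" "y \<in> X" "E k x y \<noteq> 0" using E_nonzero[OF k] .
    have "E k x x = (\<Sum>z\<in>X. E k x z * E k z x)" using E_mult[OF k k] by simp
    also have "\<dots> = (\<Sum>z\<in>X. of_real ((cmod (E k x z))\<^sup>2))"
      using E_sym[OF k] E_real[OF k] complex_norm_square[of "E k x _"] by (intro sum.cong) auto
    finally have "of_real (\<Sum>z\<in>X. (cmod (E k x z))\<^sup>2) = (0::complex)" using 0 p(2) xy by simp
    then have "(\<Sum>z\<in>X. (cmod (E k x z))\<^sup>2) = 0" by (simp only: of_real_eq_0_iff)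
    then show False using xy by (simp add: sum_nonneg_eq_0_iff)
  qed
  let ?r = "smult (1 / poly p (\<theta> 0)) p"
  have "(\<Sum>z\<in>sphere x j. E k z y) = of_nat (card (sphere x j)) * poly ?r (\<theta> j) * E k x y"
    if j: "j \<le> d" and x: "x \<in> X" and y: "y \<in> X" for x y j
  proof -
    obtain a where a: "\<And>x y. x \<in> X \<Longrightarrow> y \<in> X \<Longrightarrow>
        (if D x y = j then 1 else 0) = (\<Sum>l\<le>d. a l * E l x y)"
      using in_span_radial[of "\<lambda>i. if i = j then 1 else 0"] unfolding in_span_def by blast
    have *: "(\<Sum>z\<in>sphere x j. E k z y) = a k * E k x y" if y: "y \<in> X" for y
    proof -
      have "(\<Sum>z\<in>sphere x j. E k z y) = (\<Sum>z\<in>X. (if D x z = j then 1 else 0) * E k z y)"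
        unfolding sphere_def by (subst sum.inter_filter) (auto intro!: sum.cong)
      also have "\<dots> = (\<Sum>z\<in>X. \<Sum>l\<le>d. a l * (E l x z * E k z y))"
        using a x by (intro sum.cong) (auto simp: sum_distrib_right mult.assoc)
      also have "\<dots> = (\<Sum>l\<le>d. a l * (\<Sum>z\<in>X. E l x z * E k z y))"
        by (subst sum.swap) (simp add: sum_distrib_left)
      also have "\<dots> = (\<Sum>l\<le>d. if l = k then a k * E k x y else 0)"
        using E_mult[OF _ k] by (intro sum.cong) auto
      finally show ?thesis using k by simp
    qed
    have "(\<Sum>z\<in>sphere x j. E k z x) = (\<Sum>z\<in>sphere x j. poly p (\<theta> j))"
      using p(2) x D_sym by (intro sum.cong) (auto simp: sphere_def)
    then have "of_nat (card (sphere x j)) * poly p (\<theta> j) = a k * poly p (\<theta> 0)"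
      using *[OF x] p(2) x by simp
    then have "a k = of_nat (card (sphere x j)) * poly ?r (\<theta> j)" using p0 by (simp add: field_simps)
    then show ?thesis using *[OF y] by simp
  qed
  moreover have "degree ?r \<le> k" using p(1) degree_smult_le order.trans by blast
  ultimately show ?thesis by blast
qed

lemma sphere_sum_deg_le:
  assumes f: "deg_le m f" and m: "m \<le> d" and x: "x \<in> X"
  shows "\<exists>p. degree p \<le> m \<and>
    (\<forall>j\<le>d. (\<Sum>z\<in>sphere x j. f z) = of_nat (card (sphere x j)) * poly p (\<theta> j))"
proof -
  have "\<forall>k. \<exists>p. k \<le> d \<longrightarrow> degree p \<le> k \<and> (\<forall>x\<in>X. \<forall>y\<in>X. \<forall>j\<le>d.
    (\<Sum>z\<in>sphere x j. E k z y) = of_nat (card (sphere x j)) * poly p (\<theta> j) * E k x y)"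
    using sphere_sum_E by blast
  from choice[OF this] obtain P where P: "\<And>k. k \<le> d \<Longrightarrow> degree (P k) \<le> k"
    "\<And>k y j. k \<le> d \<Longrightarrow> y \<in> X \<Longrightarrow> j \<le> d \<Longrightarrow>
      (\<Sum>z\<in>sphere x j. E k z y) = of_nat (card (sphere x j)) * poly (P k) (\<theta> j) * E k x y"
    using x by blast
  let ?p = "\<Sum>k\<le>m. smult (proj k f x) (P k)"
  have "(\<Sum>z\<in>sphere x j. f z) = of_nat (card (sphere x j)) * poly ?p (\<theta> j)" if j: "j \<le> d" for j
  proof -
    have "f z = (\<Sum>k\<le>m. proj k f z)" if z: "z \<in> X" for z
    proof -
      have "f z = (\<Sum>k\<le>d. proj k f z)" using sum_proj[OF z] by simp
      also have "\<dots> = (\<Sum>k\<le>m. proj k f z)"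
        using f m z by (intro sum.mono_neutral_right) (auto simp: deg_le_def)
      finally show ?thesis .
    qed
    then have "(\<Sum>z\<in>sphere x j. f z) = (\<Sum>z\<in>sphere x j. \<Sum>k\<le>m. proj k f z)"
      by (intro sum.cong) (auto simp: sphere_def)
    also have "\<dots> = (\<Sum>k\<le>m. \<Sum>z\<in>sphere x j. proj k f z)" by (rule sum.swap)
    also have "\<dots> = (\<Sum>k\<le>m. \<Sum>y\<in>X. (\<Sum>z\<in>sphere x j. E k z y) * f y)"
      unfolding proj_def sum_distrib_right by (intro sum.cong refl sum.swap)
    also have "\<dots> = (\<Sum>k\<le>m. of_nat (card (sphere x j)) * poly (P k) (\<theta> j) * proj k f x)"
      using P(2) j m by (intro sum.cong refl) (simp add: proj_def sum_distrib_left mult.assoc)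
    also have "\<dots> = of_nat (card (sphere x j)) * poly ?p (\<theta> j)"
      by (simp add: poly_sum sum_distrib_left mult_ac)
    finally show ?thesis .
  qed
  moreover have "degree ?p \<le> m"
  proof (intro degree_sum_le)
    fix k assume "k \<in> {..m}"
    then show "degree (smult (proj k f x) (P k)) \<le> m"
      using P(1)[of k] m degree_smult_le[of "proj k f x" "P k"] by simp
  qed simp
  ultimately show ?thesis by blast
qed

text \<open>By \<open>sphere_sum_deg_le\<close> the averages over spheres about \<open>x\<close> are
  values of a polynomial of degree at most \<open>m\<close>. It has the distinct roots
  \<open>\<theta> j\<close> for \<open>j \<in> J\<close>, more than \<open>m\<close> of them, so it
  is zero.\<close>

lemma sphere_sum_zero:
  assumes f: "deg_le m f" and x: "x \<in> X" and J: "J \<subseteq> {..d}" "m < card J"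
    and zero: "\<And>j. j \<in> J \<Longrightarrow> (\<Sum>z\<in>sphere x j. f z) = 0" and j: "j \<le> d"
  shows "(\<Sum>z\<in>sphere x j. f z) = 0"
proof -
  have "card J \<le> Suc d" using card_mono[OF _ J(1)] by simp
  then have "m \<le> d" using J(2) by simp
  from sphere_sum_deg_le[OF f this x] obtain p where p: "degree p \<le> m"
    "\<And>j. j \<le> d \<Longrightarrow> (\<Sum>z\<in>sphere x j. f z) = of_nat (card (sphere x j)) * poly p (\<theta> j)"
    by blast
  have "poly p (\<theta> j) = 0" if "j \<in> J" for j
  proof -
    have "j \<le> d" using that J by auto
    then show ?thesis using p(2)[of j] zero[OF that] sphere_nonempty[OF x \<open>j \<le> d\<close>] by simp
  qed
  then have sub: "\<theta> ` J \<subseteq> {y. poly p y = 0}" by auto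
  have "p = 0"
  proof (rule ccontr)
    assume "p \<noteq> 0"
    then have "card (\<theta> ` J) \<le> degree p"
      using card_mono[OF poly_roots_finite[OF \<open>p \<noteq> 0\<close>] sub] card_poly_roots_bound[of p] by linarith
    moreover have "card (\<theta> ` J) = card J" by (rule card_image[OF inj_on_subset[OF inj_\<theta> J(1)]])
    ultimately show False using p(1) J(2) by simp
  qed
  then show ?thesis using p(2)[OF j] by simp
qed

text \<open>Multiplication by \<open>E d x\<close> sends a function of degree at most 1 into degrees at least
  \<open>d - 1\<close>. On the remaining \<open>d - 2\<close> levels \<open>E d x\<close> agrees with a polynomial of degree at most
  \<open>d - 3\<close> in \<open>\<theta>\<close>, multiplication by which keeps the degree at most \<open>d - 2\<close>. Hence the product
  vanishes.\<close>

lemma deg_le_1_zero: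
  assumes u: "deg_le 1 u" and d: "d \<ge> 3" and x: "x \<in> X"
    and zero: "\<And>z. z \<in> X \<Longrightarrow> D x z \<in> {0, d - 1, d} \<Longrightarrow> u z = 0" and z: "z \<in> X"
  shows "u z = 0"
proof -
  obtain r where r: "\<And>x y. x \<in> X \<Longrightarrow> y \<in> X \<Longrightarrow> E d x y = poly r (\<theta> (D x y))"
    using E_poly[of d] by blast
  have "inj_on \<theta> {1..d-2}" using inj_\<theta> by (rule inj_on_subset) auto
  from lagrange_interpolation[OF _ this, of "\<lambda>j. poly r (\<theta> j)"]
  obtain p where p: "degree p \<le> d - 3" "\<And>j. j \<in> {1..d-2} \<Longrightarrow> poly p (\<theta> j) = poly r (\<theta> j)"
    by auto
  define \<psi> where "\<psi> w = E d x w * u w" for w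
  have \<psi>_eq: "\<psi> w = poly p (\<theta> (D x w)) * u w" if w: "w \<in> X" for w
  proof (cases "D x w \<in> {0, d - 1, d}")
    case False
    then have "D x w \<in> {1..d-2}" using D_le_d[OF x w] by auto
    then show ?thesis using p(2) r[OF x w] by (simp add: \<psi>_def)
  qed (use zero[OF w] in \<open>simp add: \<psi>_def\<close>)
  have "deg_le (d - 3 + 1) (\<lambda>w. poly p (\<theta> (D x w)) * u w)"
    by (intro deg_le_mult deg_le_poly u p x) auto
  then have "proj k \<psi> w = 0" if "d - 2 < k" "k \<le> d" "w \<in> X" for k w
    using that d proj_cong[of \<psi>, OF \<psi>_eq] by (auto simp: deg_le_def)
  moreover have "proj k \<psi> w = 0" if k: "k \<le> d - 2" and w: "w \<in> X" for k w
  proof -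
    \<comment> \<open>The sum of \<open>E k w z * E d x z * u z\<close> may be read as a component
      of level \<open>k\<close> or of level \<open>d\<close>. The second reading vanishes because
      \<open>k + 1 < d\<close>.\<close>
    have "proj k \<psi> w = proj d (\<lambda>z. E k w z * u z) x"
      by (simp add: proj_def \<psi>_def mult_ac)
    also have "\<dots> = 0" using k d w x by (intro proj_mult_zero[of k _ 1] deg_le_E u) auto
    finally show ?thesis .
  qed
  ultimately have "\<psi> z = 0" using sum_proj[OF z, of \<psi>] z by (metis (no_types, lifting) atMost_iff linorder_not_le sum.neutral)
  then show ?thesis using E_d_nonzero[OF x z] by (simp add: \<psi>_def)
qed

subsection \<open>Width and dual width\<close>

abbreviation ind :: "'a set \<Rightarrow> 'a \<Rightarrow> complex" where
  "ind \<equiv> indicator"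

lemma sphere_0: "x \<in> X \<Longrightarrow> sphere x 0 = {x}"
  using D_eq_0_iff by (auto simp: sphere_def)

lemma sum_ind:
  assumes "finite A"
  shows "(\<Sum>z\<in>A. ind S z) = of_nat (card (A \<inter> S))"
  using assms by (simp add: indicator_def sum.If_cases)

text \<open>\<open>E k\<close> is a real symmetric idempotent, so the form is a squared norm. This
  links the dual width to \<open>deg_le\<close>.\<close>

lemma quad_form_E:
  assumes k: "k \<le> d"
  shows "quad_form X (E k) Y = of_real (\<Sum>z\<in>X. (cmod (proj k (ind Y) z))\<^sup>2)"
proof -
  have real: "cnj (proj k (ind Y) z) = proj k (ind Y) z" for z
    using E_real[OF k] by (simp add: proj_def indicator_def if_distrib[of cnj] cong: if_cong)
  have "of_real (\<Sum>z\<in>X. (cmod (proj k (ind Y) z))\<^sup>2) = (\<Sum>z\<in>X. proj k (ind Y) z * proj k (ind Y) z)"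
    using real complex_norm_square[of "proj k (ind Y) _"] by simp
  also have "\<dots> = (\<Sum>z\<in>X. \<Sum>x\<in>X. \<Sum>y\<in>X. ind Y x * (E k x z * E k z y) * ind Y y)"
    unfolding proj_def unfolding sum_product
    using E_sym[OF k] by (intro sum.cong refl) (simp add: mult_ac)
  also have "\<dots> = (\<Sum>x\<in>X. \<Sum>z\<in>X. \<Sum>y\<in>X. ind Y x * (E k x z * E k z y) * ind Y y)"
    by (rule sum.swap)
  also have "\<dots> = (\<Sum>x\<in>X. \<Sum>y\<in>X. \<Sum>z\<in>X. ind Y x * (E k x z * E k z y) * ind Y y)"
    by (intro sum.cong refl sum.swap)
  also have "\<dots> = (\<Sum>x\<in>X. \<Sum>y\<in>X. ind Y x * (\<Sum>z\<in>X. E k x z * E k z y) * ind Y y)"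
    by (simp add: sum_distrib_left sum_distrib_right)
  also have "\<dots> = quad_form X (E k) Y"
    using E_mult[OF k k] by (simp add: quad_form_def)
  finally show ?thesis by simp
qed

lemma quad_form_E_zero_iff:
  assumes "k \<le> d"
  shows "quad_form X (E k) Y = 0 \<longleftrightarrow> (\<forall>z\<in>X. proj k (ind Y) z = 0)"
  unfolding quad_form_E[OF assms] of_real_eq_0_iff by (simp add: sum_nonneg_eq_0_iff)

lemma deg_le_dual_width: "deg_le (dual_width X R E Y) (ind Y)"
proof -
  have "k \<le> dual_width X R E Y" if "k \<le> d" "quad_form X (E k) Y \<noteq> 0" for k
    unfolding dual_width_def diameter using that by (intro Max_ge) auto
  then show ?thesis using quad_form_E_zero_iff unfolding deg_le_def by (meson not_le)
qed

lemma dual_width_le: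
  assumes Y: "Y \<subseteq> X" "Y \<noteq> {}" and m: "deg_le m (ind Y)"
  shows "dual_width X R E Y \<le> m"
proof -
  have fin: "finite Y" using finite_subset[OF Y(1) finite_X] .
  \<comment> \<open>The level 0 component is the constant \<open>card Y / N\<close>, so the maximum
    defining the dual width is over a nonempty set.\<close>
  have "proj 0 (ind Y) z \<noteq> 0" if "z \<in> X" for z
  proof -
    have "proj 0 (ind Y) z = (\<Sum>y\<in>X. 1 / N * ind Y y)"
      unfolding proj_def using E_0 that by (intro sum.cong) auto
    also have "\<dots> = 1 / N * of_nat (card Y)"
      using Y by (simp add: sum_ind Int_absorb1 flip: sum_divide_distrib)
    finally show ?thesis using Y fin by simp
  qed
  then have "quad_form X (E 0) Y \<noteq> 0" using quad_form_E_zero_iff[of 0 Y] X_nonempty by blast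
  then have "{i. i \<le> d \<and> quad_form X (E i) Y \<noteq> 0} \<noteq> {}" by blast
  then have "Max {i. i \<le> d \<and> quad_form X (E i) Y \<noteq> 0} \<in> {i. i \<le> d \<and> quad_form X (E i) Y \<noteq> 0}"
    by (intro Max_in) auto
  then have "dual_width X R E Y \<le> d" "quad_form X (E (dual_width X R E Y)) Y \<noteq> 0"
    unfolding dual_width_def diameter by auto
  then show ?thesis using m quad_form_E_zero_iff unfolding deg_le_def by (meson not_le)
qed

lemma quad_form_distance_iff:
  assumes "Y \<subseteq> X"
  shows "quad_form X (distance_matrix X R i) Y \<noteq> 0 \<longleftrightarrow> (\<exists>x\<in>Y. \<exists>y\<in>Y. D x y = i)"
proof -
  have "quad_form X (distance_matrix X R i) Y
      = of_real (\<Sum>x\<in>X. \<Sum>y\<in>X. if x \<in> Y \<and> y \<in> Y \<and> D x y = i then 1 else 0)"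
    unfolding quad_form_def of_real_sum
    by (intro sum.cong refl) (auto simp: distance_matrix_def indicator_def)
  then have "quad_form X (distance_matrix X R i) Y = 0 \<longleftrightarrow>
      (\<Sum>x\<in>X. \<Sum>y\<in>X. if x \<in> Y \<and> y \<in> Y \<and> D x y = i then 1 else 0) = (0::real)"
    by (simp only: of_real_eq_0_iff)
  also have "\<dots> \<longleftrightarrow> (\<forall>x\<in>X. \<forall>y\<in>X. \<not> (x \<in> Y \<and> y \<in> Y \<and> D x y = i))"
    by (simp add: sum_nonneg_eq_0_iff sum_nonneg)
  finally show ?thesis using assms by blast
qed

lemma width_eq: "Y \<subseteq> X \<Longrightarrow> width X R Y = Max {i. i \<le> d \<and> (\<exists>x\<in>Y. \<exists>y\<in>Y. D x y = i)}"
  unfolding width_def diameter using quad_form_distance_iff by simp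

lemma D_le_width: "Y \<subseteq> X \<Longrightarrow> x \<in> Y \<Longrightarrow> y \<in> Y \<Longrightarrow> D x y \<le> width X R Y"
  unfolding width_eq by (rule Max_ge) (auto intro: D_le_d)

lemma width_attained:
  assumes "Y \<subseteq> X" "Y \<noteq> {}"
  obtains x y where "x \<in> Y" "y \<in> Y" "D x y = width X R Y"
proof -
  obtain x where "x \<in> Y" using assms by blast
  then have "\<exists>x\<in>Y. \<exists>y\<in>Y. D x y = 0" using D_self by blast
  then have "{i. i \<le> d \<and> (\<exists>x\<in>Y. \<exists>y\<in>Y. D x y = i)} \<noteq> {}" by auto
  then have "Max {i. i \<le> d \<and> (\<exists>x\<in>Y. \<exists>y\<in>Y. D x y = i)} \<in> {i. i \<le> d \<and> (\<exists>x\<in>Y. \<exists>y\<in>Y. D x y = i)}"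
    by (intro Max_in) auto
  then show ?thesis using that unfolding width_eq[OF assms(1)] by blast
qed

text \<open>If \<open>d > n + m\<close>, then about a point \<open>x\<close> of \<open>Y\<close> the
  indicator vanishes on the \<open>d - n > m\<close> spheres of radius above \<open>n\<close>. By
  \<open>sphere_sum_zero\<close> it then vanishes at \<open>x\<close>, which is absurd.\<close>

lemma diameter_le_width_add_degree:
  assumes Y: "Y \<subseteq> X" "Y \<noteq> {}" and m: "deg_le m (ind Y)"
    and n: "\<And>x y. x \<in> Y \<Longrightarrow> y \<in> Y \<Longrightarrow> D x y \<le> n"
  shows "d \<le> n + m"
proof (rule ccontr)
  assume less: "\<not> d \<le> n + m"
  obtain x where x: "x \<in> Y" "x \<in> X" using Y by blast
  have "(\<Sum>z\<in>sphere x 0. ind Y z) = 0"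
  proof (rule sphere_sum_zero[OF m x(2), of "{n<..d}"])
    fix j assume "j \<in> {n<..d}"
    then show "(\<Sum>z\<in>sphere x j. ind Y z) = 0"
      using n[OF x(1)] by (intro sum.neutral) (fastforce simp: sphere_def indicator_def)
  qed (use less in auto)
  then show False using x by (simp add: sphere_0)
qed

text \<open>Upper bounds for width and dual width that add up to \<open>d\<close> must both be
  attained, by the preceding lower bound.\<close>

lemma descendentI:
  assumes Y: "Y \<subseteq> X" "Y \<noteq> {}" and m: "deg_le m (ind Y)"
    and n: "\<And>x y. x \<in> Y \<Longrightarrow> y \<in> Y \<Longrightarrow> D x y \<le> n" and "n + m = d"
  shows "Y \<in> descendents X R E" "width X R Y = n"
proof -
  have 1: "width X R Y \<le> n" using width_attained[OF Y] n by metis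
  have 2: "dual_width X R E Y \<le> m" using dual_width_le[OF Y m] .
  have 3: "d \<le> width X R Y + dual_width X R E Y"
    using diameter_le_width_add_degree[OF Y deg_le_dual_width] D_le_width[OF Y(1)] by blast
  show "width X R Y = n" using 1 2 3 assms(5) by linarith
  show "Y \<in> descendents X R E"
    using Y 1 2 3 assms(5) diameter by (simp add: descendents_def)
qed

lemma descendentD:
  assumes "Y \<in> descendents X R E"
  shows "Y \<subseteq> X" "Y \<noteq> {}" "width X R Y \<le> d" "deg_le (d - width X R Y) (ind Y)"
proof -
  have *: "width X R Y + dual_width X R E Y = d" and "Y \<subseteq> X" "Y \<noteq> {}"
    using assms diameter by (auto simp: descendents_def)
  then show "Y \<subseteq> X" "Y \<noteq> {}" "width X R Y \<le> d" by auto
  have "dual_width X R E Y = d - width X R Y" using * by simp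
  then show "deg_le (d - width X R Y) (ind Y)" using deg_le_dual_width[of Y] by simp
qed

text \<open>About a point \<open>z\<close> of \<open>T\<close> outside \<open>S\<close>, the spheres
  of radius 0 and of radius above the width \<open>w\<close> of \<open>S\<close> miss
  \<open>S\<close>. These are \<open>d - w + 1\<close> spheres, one more than the degree of the
  indicator, so every sphere about \<open>z\<close> would miss \<open>S\<close>.\<close>

lemma descendent_maximal:
  assumes S: "S \<in> descendents X R E" and T: "S \<subseteq> T" "T \<subseteq> X"
    and le: "\<And>x y. x \<in> T \<Longrightarrow> y \<in> T \<Longrightarrow> D x y \<le> width X R S"
  shows "T = S"
proof (rule ccontr)
  assume "T \<noteq> S"
  then obtain z where z: "z \<in> T" "z \<notin> S" "z \<in> X" using T by blast
  obtain s where s: "s \<in> S" "s \<in> X" using descendentD(1,2)[OF S] by blast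
  let ?J = "insert 0 {width X R S<..d}"
  have "(\<Sum>w\<in>sphere z (D z s). ind S w) = 0"
  proof (rule sphere_sum_zero[OF descendentD(4)[OF S] z(3), of ?J])
    fix j assume "j \<in> ?J"
    then show "(\<Sum>w\<in>sphere z j. ind S w) = 0"
    proof
      assume "j = 0"
      then show ?thesis using z by (simp add: sphere_0)
    next
      assume "j \<in> {width X R S<..d}"
      then show ?thesis using le[OF z(1)] T(1)
        by (intro sum.neutral) (fastforce simp: sphere_def indicator_def)
    qed
  qed (use D_le_d z s in auto)
  then have "sphere z (D z s) \<inter> S = {}" by (simp add: sum_ind)
  then show False using s by (auto simp: sphere_def)
qed

end

section \<open>Intersections of hyperplanes\<close>

lemma qnum_diff: "a \<le> b \<Longrightarrow> qnum q b - qnum q a = q ^ a * qnum q (b - a)"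
proof (induction b rule: dec_induct)
  case (step n)
  then show ?case by (simp add: qnum_def Suc_diff_le algebra_simps flip: power_add)
qed (simp add: qnum_def)

text \<open>The condition \<open>qnum_2\<close> says \<open>q \<noteq> -1\<close>; together with
  \<open>q \<noteq> 0\<close> and the hyperplane count it leads to \<open>q_ge_1\<close>.\<close>

locale descendent_geometry = q_polynomial_graph +
  fixes q :: real and \<xi> \<zeta> :: complex
  assumes d: "d \<ge> 3"
    and \<theta>_eq: "j \<le> d \<Longrightarrow> \<theta> j = \<xi> * of_real (qnum q (d - j)) + \<zeta>"
    and \<xi>: "\<xi> \<noteq> 0"
    and q_nonzero: "q \<noteq> 0" and qnum_2: "qnum q 2 \<noteq> 0"
    and unique: "x \<in> X \<Longrightarrow> y \<in> X \<Longrightarrow>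
      \<exists>!Y. Y \<in> descendents X R E \<and> width X R Y = D x y \<and> x \<in> Y \<and> y \<in> Y"
begin

section \<open>Counting hyperplanes through two vertices\<close>

definition hyperplanes :: "'a \<Rightarrow> 'a \<Rightarrow> 'a set set" where
  "hyperplanes x y = {H \<in> descendents X R E. width X R H = d - 1 \<and> x \<in> H \<and> y \<in> H}"

lemma finite_hyperplanes [simp]: "finite (hyperplanes x y)"
  by (rule finite_subset[of _ "Pow X"]) (auto simp: hyperplanes_def dest: descendentD)

lemma hyperplanes_diameter:
  assumes "D x y = d"
  shows "hyperplanes x y = {}"
proof -
  have False if "H \<in> hyperplanes x y" for H
    using D_le_width[of H x y] descendentD(1)[of H] that assms d by (auto simp: hyperplanes_def)
  then show ?thesis by blast
qed

text \<open>For fixed \<open>x\<close> both sides have degree at most 1 in \<open>y\<close>, and they agree at the distances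
  \<open>d - 1\<close> and \<open>d\<close> from \<open>x\<close>. The average over the sphere of radius \<open>j\<close> about \<open>x\<close> is affine in
  \<open>\<theta> j\<close>, so they also agree at \<open>x\<close>.\<close>

lemma card_hyperplanes:
  assumes x: "x \<in> X" and y: "y \<in> X"
  shows "real (card (hyperplanes x y)) = qnum q (d - D x y)"
proof -
  \<comment> \<open>The linear polynomial inverts the affine formula for \<theta>, so its value is
    \<open>qnum q (d - D x z)\<close>. The set \<open>hyperplanes x x\<close> consists of all
    hyperplanes through \<open>x\<close>.\<close>
  define u where "u z = (\<Sum>H\<in>hyperplanes x x. ind H z) - poly [:- \<zeta> / \<xi>, 1 / \<xi>:] (\<theta> (D x z))" for z
  have u: "u z = of_nat (card (hyperplanes x z)) - of_real (qnum q (d - D x z))" if z: "z \<in> X" for z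
  proof -
    have "(\<Sum>H\<in>hyperplanes x x. ind H z) = of_nat (card {H \<in> hyperplanes x x. z \<in> H})"
      by (simp add: indicator_def sum.If_cases Int_def)
    also have "{H \<in> hyperplanes x x. z \<in> H} = hyperplanes x z"
      by (auto simp: hyperplanes_def)
    finally show ?thesis using \<theta>_eq[OF D_le_d[OF x z]] \<xi> by (simp add: u_def field_simps)
  qed
  have "deg_le 1 (ind H)" if "H \<in> hyperplanes x x" for H
    using descendentD(4)[of H] that d by (auto simp: hyperplanes_def)
  then have deg: "deg_le 1 u"
    unfolding u_def using d x by (intro deg_le_diff deg_le_sum deg_le_poly) auto
  have zero: "u z = 0" if z: "z \<in> X" "D x z = d - 1 \<or> D x z = d" for z
  proof (cases "D x z = d")
    case True
    then show ?thesis using u[OF z(1)] hyperplanes_diameter[OF True] by (simp add: qnum_def)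
  next
    case False
    then have dist: "D x z = d - 1" using z by simp
    \<comment> \<open>The uniqueness hypothesis for distance \<open>d - 1\<close> gives exactly one
      hyperplane, matching \<open>qnum q 1 = 1\<close>.\<close>
    have "\<exists>!H. H \<in> hyperplanes x z" using unique[OF x z(1)] dist by (simp add: hyperplanes_def)
    then have "card (hyperplanes x z) = 1"
      by (metis card_1_singleton_iff One_nat_def is_singletonI' is_singleton_the_elem empty_iff)
    then show ?thesis using u[OF z(1)] dist d by (simp add: qnum_def)
  qed
  have "(\<Sum>z\<in>sphere x 0. u z) = 0"
    by (rule sphere_sum_zero[OF deg x, of "{d - 1, d}"])
      (use d zero in \<open>auto simp: sphere_def intro!: sum.neutral\<close>)
  then have "u x = 0" using x by (simp add: sphere_0)
  then have "u y = 0"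
    using zero D_eq_0_iff[OF x] by (intro deg_le_1_zero[OF deg d x _ y]) auto
  then have "complex_of_real (real (card (hyperplanes x y))) = of_real (qnum q (d - D x y))"
    using u[OF y] by simp
  then show ?thesis by (simp only: of_real_eq_iff)
qed

text \<open>At distance \<open>d - 2\<close> the count is \<open>1 + q\<close>. It is a natural
  number other than 0 and 1, hence at least 2.\<close>

lemma q_ge_1: "q \<ge> 1"
proof -
  obtain x where x: "x \<in> X" using X_nonempty by blast
  obtain y where y: "y \<in> X" "D x y = d - 2"
    using sphere_nonempty[OF x, of "d - 2"] by (auto simp: sphere_def)
  have "d - (d - 2) = 2" using d by simp
  then have "real (card (hyperplanes x y)) = 1 + q"
    using card_hyperplanes[OF x y(1)] y(2) by (simp add: qnum_def numeral_2_eq_2)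
  moreover from this have "card (hyperplanes x y) \<noteq> 0" "card (hyperplanes x y) \<noteq> 1"
    using qnum_2 q_nonzero by (auto simp: qnum_def numeral_2_eq_2)
  ultimately show ?thesis by linarith
qed

lemma qnum_less: "l < k \<Longrightarrow> qnum q l < qnum q k"
  by (rule lift_Suc_mono_less[of "qnum q"]) (use q_ge_1 in \<open>auto simp: qnum_def\<close>)

lemma descendent_unique:
  assumes "S \<in> descendents X R E" "T \<in> descendents X R E" "x \<in> S" "y \<in> S" "x \<in> T" "y \<in> T"
    and "width X R S = D x y" "width X R T = D x y"
  shows "S = T"
  using unique[of x y] descendentD(1)[OF assms(1)] assms by blast

text \<open>Hyperplanes containing \<open>x\<close> and \<open>y\<close> are intersected one by one. As long as the intersection
  has width \<open>d - l > D x y\<close>, two of its points at distance \<open>d - l\<close> lie in fewer hyperplanes than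
  \<open>x\<close> and \<open>y\<close> do, so there is a hyperplane that cuts it properly. This raises the degree by one
  and, by the hypothesis on larger widths, lowers the width.\<close>

lemma intersection_of_hyperplanes:
  assumes larger: "\<And>l T p r H. l < k \<Longrightarrow> T \<in> descendents X R E \<Longrightarrow> width X R T = d - l \<Longrightarrow>
      p \<in> T \<Longrightarrow> r \<in> T \<Longrightarrow> D p r = d - l \<Longrightarrow> H \<in> hyperplanes p r \<Longrightarrow> T \<subseteq> H"
    and k: "k \<le> d" and xy: "x \<in> X" "y \<in> X" "D x y = d - k" and H0: "H0 \<in> hyperplanes x y"
    and l: "1 \<le> l" "l \<le> k"
  shows "\<exists>G. G \<subseteq> hyperplanes x y \<and> H0 \<in> G \<and> \<Inter>G \<in> descendents X R E \<and> width X R (\<Inter>G) = d - l"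
  using l
proof (induction l rule: dec_induct)
  case base
  then show ?case using H0 by (intro exI[of _ "{H0}"]) (auto simp: hyperplanes_def)
next
  case (step l)
  then obtain G where G: "G \<subseteq> hyperplanes x y" "H0 \<in> G" "\<Inter>G \<in> descendents X R E"
    "width X R (\<Inter>G) = d - l" by auto
  define T where "T = \<Inter>G"
  have T: "T \<in> descendents X R E" "width X R T = d - l" using G by (auto simp: T_def)
  obtain p r where pr: "p \<in> T" "r \<in> T" "D p r = d - l"
    using width_attained[OF descendentD(1,2)[OF T(1)]] T(2) by metis
  have prX: "p \<in> X" "r \<in> X" using pr descendentD(1)[OF T(1)] by auto
  have lk: "l < k" "l < d" using step k by auto
  \<comment> \<open>The two counts are \<open>qnum q l\<close> and \<open>qnum q k\<close>.\<close>
  have "real (card (hyperplanes p r)) < real (card (hyperplanes x y))"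
    using card_hyperplanes[OF prX] card_hyperplanes[OF xy(1,2)] pr(3) xy(3) qnum_less[OF lk(1)] lk k
    by simp
  then have "\<not> hyperplanes x y \<subseteq> hyperplanes p r"
    using card_mono[OF finite_hyperplanes[of p r], of "hyperplanes x y"] by linarith
  then obtain H where H: "H \<in> hyperplanes x y" "\<not> (p \<in> H \<and> r \<in> H)"
    by (auto simp: hyperplanes_def)
  have Hd: "H \<in> descendents X R E" "width X R H = d - 1" using H by (auto simp: hyperplanes_def)
  have xyG: "x \<in> T \<inter> H" using G(1) H(1) by (auto simp: T_def hyperplanes_def)
  have sub: "T \<inter> H \<subseteq> X" using descendentD(1)[OF Hd(1)] by auto
  have dist: "D p' r' \<le> d - Suc l" if "p' \<in> T \<inter> H" "r' \<in> T \<inter> H" for p' r'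
  proof -
    have "D p' r' \<le> d - l" using D_le_width[OF descendentD(1)[OF T(1)], of p' r'] that T(2) by simp
    moreover have "D p' r' \<noteq> d - l"
    proof
      assume "D p' r' = d - l"
      then have "T \<subseteq> H" using larger[OF lk(1) T, of p' r' H] that Hd by (auto simp: hyperplanes_def)
      then show False using H(2) pr by auto
    qed
    ultimately show ?thesis by linarith
  qed
  have "deg_le (l + 1) (\<lambda>z. ind T z * ind H z)"
    using descendentD(4)[OF T(1)] descendentD(4)[OF Hd(1)] T(2) Hd(2) lk d by (intro deg_le_mult) auto
  moreover have "(\<lambda>z. ind T z * ind H z) = ind (T \<inter> H)" by (simp add: fun_eq_iff indicator_inter_arith)
  ultimately have deg: "deg_le (Suc l) (ind (T \<inter> H))" by simp
  have ne: "T \<inter> H \<noteq> {}" using xyG by blast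
  have sum: "d - Suc l + Suc l = d" using lk by simp
  have "\<Inter>(insert H G) = T \<inter> H" by (auto simp: T_def)
  then show ?case
    using descendentI[OF sub ne deg dist sum] G(1,2) H(1) by (intro exI[of _ "insert H G"]) auto
qed

text \<open>Strong induction on \<open>k = d - width X R T\<close>: the induction hypothesis
  discharges \<open>larger\<close>, so the chain of intersections can start from \<open>H\<close>.
  It ends in a descendent of width \<open>d - k\<close> through \<open>p\<close> and
  \<open>r\<close>, which is \<open>T\<close> by uniqueness.\<close>

lemma descendent_subset_hyperplane:
  assumes "T \<in> descendents X R E" "p \<in> T" "r \<in> T" "D p r = width X R T" "H \<in> hyperplanes p r"
  shows "T \<subseteq> H"
proof -
  have "k \<le> d \<Longrightarrow> T \<in> descendents X R E \<Longrightarrow> width X R T = d - k \<Longrightarrow>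
      p \<in> T \<Longrightarrow> r \<in> T \<Longrightarrow> D p r = d - k \<Longrightarrow> H \<in> hyperplanes p r \<Longrightarrow> T \<subseteq> H" for k T p r H
  proof (induction k arbitrary: T p r H rule: less_induct)
    case (less k)
    have pr: "p \<in> X" "r \<in> X" using less.prems descendentD(1) by blast+
    show ?case
    proof (cases "k = 0")
      case True
      then show ?thesis using less.prems hyperplanes_diameter[of p r] by simp
    next
      case False
      have "\<exists>G. G \<subseteq> hyperplanes p r \<and> H \<in> G \<and> \<Inter>G \<in> descendents X R E \<and> width X R (\<Inter>G) = d - k"
      proof (rule intersection_of_hyperplanes[of k])
        show "T' \<subseteq> H'" if "l < k" "T' \<in> descendents X R E" "width X R T' = d - l" "p' \<in> T'"
          "r' \<in> T'" "D p' r' = d - l" "H' \<in> hyperplanes p' r'" for l T' p' r' H'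
          using less.IH[OF that(1)] that less.prems(1) by (meson less_le_trans less_imp_le)
      qed (use less.prems pr False in auto)
      then obtain G where G: "G \<subseteq> hyperplanes p r" "H \<in> G" "\<Inter>G \<in> descendents X R E"
        "width X R (\<Inter>G) = d - k" by blast
      have "p \<in> \<Inter>G" "r \<in> \<Inter>G" using G(1) by (auto simp: hyperplanes_def)
      then have "T = \<Inter>G"
        using descendent_unique[OF less.prems(2) G(3) less.prems(4,5)] less.prems(3,6) G(4) by simp
      then show ?thesis using G(2) by auto
    qed
  qed
  from this[of "d - width X R T"] show ?thesis using assms descendentD(3)[OF assms(1)] by simp
qed

text \<open>Two points at distance less than \<open>d\<close> lie in some hyperplane, as their count
  is positive; the chain starts there. The assumption \<open>larger\<close> now holds by
  \<open>descendent_subset_hyperplane\<close>.\<close>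

lemma descendent_eq_Inter_hyperplanes:
  assumes T: "T \<in> descendents X R E" "width X R T < d"
  obtains G where "\<And>H. H \<in> G \<Longrightarrow> H \<in> descendents X R E \<and> width X R H = d - 1" "T = \<Inter>G"
proof -
  obtain p r where pr: "p \<in> T" "r \<in> T" "D p r = width X R T"
    using width_attained[OF descendentD(1,2)[OF T(1)]] by metis
  have prX: "p \<in> X" "r \<in> X" using pr descendentD(1)[OF T(1)] by auto
  have "qnum q 0 < qnum q (d - D p r)" using pr T by (intro qnum_less) simp
  then have "real (card (hyperplanes p r)) > 0" using card_hyperplanes[OF prX] by (simp add: qnum_def)
  then have "hyperplanes p r \<noteq> {}" by auto
  then obtain H where H: "H \<in> hyperplanes p r" by blast
  have "\<exists>G. G \<subseteq> hyperplanes p r \<and> H \<in> G \<and> \<Inter>G \<in> descendents X R E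
      \<and> width X R (\<Inter>G) = d - (d - width X R T)"
  proof (rule intersection_of_hyperplanes[of "d - width X R T"])
    show "T' \<subseteq> H'" if "l < d - width X R T" "T' \<in> descendents X R E" "width X R T' = d - l" "p' \<in> T'"
          "r' \<in> T'" "D p' r' = d - l" "H' \<in> hyperplanes p' r'" for l T' p' r' H'
      using descendent_subset_hyperplane that by simp
  qed (use T pr prX H in auto)
  then obtain G where G: "G \<subseteq> hyperplanes p r" "\<Inter>G \<in> descendents X R E" "width X R (\<Inter>G) = D p r"
    using T(2) pr(3) by auto
  have "p \<in> \<Inter>G" "r \<in> \<Inter>G" using G(1) by (auto simp: hyperplanes_def)
  then have "T = \<Inter>G"
    using descendent_unique[OF T(1) G(2) pr(1,2)] pr(3) G(3) by simp
  moreover have "H \<in> descendents X R E \<and> width X R H = d - 1" if "H \<in> G" for H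
    using that G(1) by (auto simp: hyperplanes_def)
  ultimately show ?thesis using that by blast
qed

text \<open>Each hyperplane in an intersection representing \<open>Y\<close> contains
  \<open>x\<close> and \<open>y\<close>, hence \<open>S\<close>. If \<open>Y\<close> has width
  \<open>d\<close>, maximality gives \<open>Y = X\<close>.\<close>

lemma descendent_contains_spanned:
  assumes Y: "Y \<in> descendents X R E" and S: "S \<in> descendents X R E" "width X R S = D x y"
    and xy: "x \<in> Y" "y \<in> Y" "x \<in> S" "y \<in> S"
  shows "S \<subseteq> Y"
proof (cases "width X R Y < d")
  case True
  obtain G where G: "\<And>H. H \<in> G \<Longrightarrow> H \<in> descendents X R E \<and> width X R H = d - 1" "Y = \<Inter>G"
    using descendent_eq_Inter_hyperplanes[OF Y True] by metis
  have "S \<subseteq> H" if "H \<in> G" for H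
  proof (rule descendent_subset_hyperplane[OF S(1) xy(3,4)])
    show "H \<in> hyperplanes x y" using G that xy by (auto simp: hyperplanes_def)
  qed (use S in simp)
  then show ?thesis using G(2) by blast
next
  case False
  then have "width X R Y = d" using descendentD(3)[OF Y] by simp
  then have "X = Y" using descendent_maximal[OF Y descendentD(1)[OF Y]] D_le_d by simp
  then show ?thesis using descendentD(1)[OF S(1)] by simp
qed

lemma descendents_Int:
  assumes Y: "Y\<^sub>1 \<in> descendents X R E" "Y\<^sub>2 \<in> descendents X R E" and ne: "Y\<^sub>1 \<inter> Y\<^sub>2 \<noteq> {}"
  shows "Y\<^sub>1 \<inter> Y\<^sub>2 \<in> descendents X R E"
proof -
  have sub: "Y\<^sub>1 \<inter> Y\<^sub>2 \<subseteq> X" using descendentD(1)[OF Y(1)] by auto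
  obtain x y where xy: "x \<in> Y\<^sub>1 \<inter> Y\<^sub>2" "y \<in> Y\<^sub>1 \<inter> Y\<^sub>2" "D x y = width X R (Y\<^sub>1 \<inter> Y\<^sub>2)"
    using width_attained[OF sub ne] .
  then obtain S where S: "S \<in> descendents X R E" "width X R S = D x y" "x \<in> S" "y \<in> S"
    using unique[of x y] sub by blast
  have "S \<subseteq> Y\<^sub>1 \<inter> Y\<^sub>2"
    using descendent_contains_spanned[OF Y(1) S(1,2) _ _ S(3,4)] descendent_contains_spanned[OF Y(2) S(1,2) _ _ S(3,4)]
      xy(1,2) by simp
  moreover have "D u v \<le> width X R S" if "u \<in> Y\<^sub>1 \<inter> Y\<^sub>2" "v \<in> Y\<^sub>1 \<inter> Y\<^sub>2" for u v
    using D_le_width[OF sub that] unfolding S(2) xy(3) .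
  ultimately have "Y\<^sub>1 \<inter> Y\<^sub>2 = S" using descendent_maximal[OF S(1) _ sub] by blast
  then show ?thesis using S(1) by simp
qed

end

section \<open>From classical parameters to the geometric assumptions\<close>

theorem mainTheorem9:
  fixes X :: "'a set" and R :: "'a rel" and E :: "nat \<Rightarrow> 'a cmat"
    and d :: nat and q \<alpha> \<beta> :: real
  assumes "distance_regular X R"
    and "graph_diameter X R = d"
    and "d \<ge> 3"
    and "classical_parameters X R d q \<alpha> \<beta>"
    and "standard_ordering X R q E"
    and "\<forall>i\<le>d. \<forall>x\<in>X. \<forall>y\<in>X. gdist R x y = i \<longrightarrow>
           (\<exists>!Y. Y \<in> descendents X R E \<and> width X R Y = i \<and> x \<in> Y \<and> y \<in> Y)"
  shows "\<forall>Y\<^sub>1\<in>descendents X R E. \<forall>Y\<^sub>2\<in>descendents X R E.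
           Y\<^sub>1 \<inter> Y\<^sub>2 \<noteq> {} \<longrightarrow> Y\<^sub>1 \<inter> Y\<^sub>2 \<in> descendents X R E"
proof -
  have conn: "connected_graph X R" using assms(1) by (simp add: distance_regular_def)
  obtain b c where arr: "intersection_array X R b c"
    and bc: "\<And>i. i \<le> d \<Longrightarrow> real (b i) = (qnum q d - qnum q i) * (\<beta> - \<alpha> * qnum q i)"
      "\<And>i. i \<le> d \<Longrightarrow> real (c i) = qnum q i * (1 + \<alpha> * qnum q (i - 1))"
    using assms(4) unfolding classical_parameters_def by blast
  interpret distance_regular_graph X R d b c
    using conn assms(2) arr by unfold_locales
  have qnum_nonzero: "qnum q m \<noteq> 0" if m: "1 \<le> m" "m \<le> d" for m
  proof -
    have "c m > 0" using c_pos[of "m - 1"] m by simp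
    then show ?thesis using bc(2)[OF m(2)] by auto
  qed
  \<comment> \<open>For \<open>q = 0\<close> all \<open>qnum q m\<close> with
    \<open>m \<ge> 1\<close> equal 1, which would force \<open>b 1 = 0\<close>.\<close>
  have q_nonzero: "q \<noteq> 0"
  proof
    assume "q = 0"
    then have "qnum q m = 1" if "m \<ge> 1" for m
      using that by (simp add: qnum_def power_0_left if_distrib cong: if_cong)
    then have "real (b 1) = 0" using bc(1)[of 1] assms(3) by simp
    then show False using b_pos[of 1] assms(3) by simp
  qed
  \<comment> \<open>The difference is \<open>q ^ m * qnum q (n - m)\<close>, a product of nonzero
    factors; this is what makes \<theta> injective.\<close>
  have qnum_neq: "qnum q m \<noteq> qnum q n" if "m < n" "n \<le> d" for m n
    using qnum_diff[of m n q] qnum_nonzero[of "n - m"] q_nonzero that by auto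
  obtain \<theta> \<xi> \<zeta> where \<theta>: "dual_eigenvalues X R E \<theta>" "\<xi> \<noteq> 0"
      "\<And>i. i \<le> d \<Longrightarrow> \<theta> i = \<xi> * complex_of_real (qnum q (d - i)) + \<zeta>"
    and Q: "Q_polynomial X R E"
    using assms(2,5) unfolding standard_ordering_def by blast
  obtain as bs cs where "\<And>i. i \<in> {1..d} \<Longrightarrow> bs (i - 1) * cs i \<noteq> 0"
    "\<And>i x y. i \<le> d \<Longrightarrow> E 1 x y * E i x y =
           ((if i = 0 then 0 else bs (i - 1) * E (i - 1) x y) + as i * E i x y
             + (if i = d then 0 else cs (i + 1) * E (i + 1) x y)) / of_nat (card X)"
    using Q unfolding Q_polynomial_def Let_def assms(2) by blast
  moreover have "inj_on \<theta> {..d}"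
  proof (rule inj_onI)
    fix i j assume ij: "i \<in> {..d}" "j \<in> {..d}" "\<theta> i = \<theta> j"
    then have "qnum q (d - i) = qnum q (d - j)" using \<theta>(2,3) by simp
    then have "d - i = d - j"
      using qnum_neq[of "d - i" "d - j"] qnum_neq[of "d - j" "d - i"] by (metis diff_le_self nat_neq_iff)
    then show "i = j" using ij by (simp add: eq_diff_iff)
  qed
  moreover have "idempotent_ordering X R E" using Q by (simp add: Q_polynomial_def)
  ultimately interpret descendent_geometry X R d b c E \<theta> as bs cs q \<xi> \<zeta>
    using assms(3,6) \<theta> q_nonzero qnum_nonzero[of 2] D_le_d by unfold_locales auto
  show ?thesis using descendents_Int by blast
qed

end
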